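(* Let $x\in A$ be a solvable element such that $v_{\rho,\sigma}(x)\ge\rho+\sigma$ for all $(\rho,\sigma)\in\mathcal P$. Suppose that the edges of $x$ are $E_{\rho_1,\sigma_1}(x),\dots,E_{\rho_k,\sigma_k}(x)$, where $k\ge 2$, $(\rho_1,\sigma_1),\dots,(\rho_k,\sigma_k)\in\mathcal P$ and $\rho_1/\sigma_1<\cdots<\rho_k/\sigma_k$. For each $1\le l\le k$ write the $(\rho_l,\sigma_l)$-polynomial of $x$ as $f_l^{r_l}$ with $r_l>1$ an integer and $f_l\in\mathbb F[X,Y]$ not equal to $\kappa^n$ for any $\kappa\in\mathbb F[X,Y]$ and any integer $n>1$. Then $$(r_1,r_2,\dots,r_k)>1,$$ where $(r_1,\dots,r_k)$ denotes the greatest common divisor.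
   Context: $\mathbb F$ is a field of characteristic zero and $A$ is the (first) Weyl algebra over $\mathbb F$: the associative unital $\mathbb F$-algebra generated by $p,q$ subject to $[p,q]=pq-qp=1$; the elements $p^iq^j$ ($i,j\ge 0$) form a basis of $A$. $\mathcal P$ is the set of all pairs of relatively prime positive integers. For $x=\sum\alpha_{ij}p^iq^j\in A$ and $(\rho,\sigma)\in\mathcal P$ let $E(x)=\{(i,j):\alpha_{ij}\ne 0\}$, $v_{\rho,\sigma}(x)=\sup_{(i,j)\in E(x)}(i\rho+j\sigma)$ (with $v_{\rho,\sigma}(0)=-\infty$), and $E_{\rho,\sigma}(x)=\{(i,j)\in E(x): i\rho+j\sigma=v_{\rho,\sigma}(x)\}$. The $(\rho,\sigma)$-polynomial of $x$ is $\sum_{(i,j)\in E_{\rho,\sigma}(x)}\alpha_{ij}X^iY^j\in\mathbb F[X,Y]$. $E_{\rho,\sigma}(x)$ is called an edge of $x$ if it contains more than one point. An element $x\in A$ is solvable if there is $y\in A$ with $[x,y]=xy-yx=1$. *)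

theory Defs
  imports
    "HOL-Library.Poly_Mapping"
    "HOL-Library.Extended_Real"
    "HOL-Computational_Algebra.Polynomial"
begin

section \<open>The free algebra on two generators\<close>

datatype gen = Gen_p | Gen_q

text \<open>The free monoid of words in the two generators is written additively (addition is
  concatenation), because the convolution product on \<^type>\<open>poly_mapping\<close> requires an additive monoid
  of exponents. Hence \<open>word \<Rightarrow>\<^sub>0 'f\<close> is the free associative unital algebra on \<open>p, q\<close>.\<close>

datatype word = Word (letters: "gen list")

instantiation word :: monoid_add
begin
definition "0 = Word []"
definition "u + v = Word (letters u @ letters v)"
instance by standard (auto simp: zero_word_def plus_word_def)
end

definition free_gen :: "gen \<Rightarrow> (word \<Rightarrow>\<^sub>0 'f::field_char_0)"
  where "free_gen g = Poly_Mapping.single (Word [g]) 1"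

definition free_const :: "'f \<Rightarrow> (word \<Rightarrow>\<^sub>0 'f::field_char_0)"
  where "free_const c = Poly_Mapping.single 0 c"

section \<open>The Weyl algebra\<close>

text \<open>The two-sided ideal generated by \<open>pq - qp - 1\<close>; it is closed under scalar multiplication since
  the multipliers may be constants.\<close>

inductive_set weyl_ideal :: "(word \<Rightarrow>\<^sub>0 'f::field_char_0) set" where
  relation: "free_gen Gen_p * free_gen Gen_q - free_gen Gen_q * free_gen Gen_p - 1 \<in> weyl_ideal"
| zero: "0 \<in> weyl_ideal"
| add: "a \<in> weyl_ideal \<Longrightarrow> b \<in> weyl_ideal \<Longrightarrow> a + b \<in> weyl_ideal"
| mult: "a \<in> weyl_ideal \<Longrightarrow> u * a * v \<in> weyl_ideal"

definition weyl_rel :: "(word \<Rightarrow>\<^sub>0 'f::field_char_0) \<Rightarrow> (word \<Rightarrow>\<^sub>0 'f) \<Rightarrow> bool"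
  where "weyl_rel a b \<longleftrightarrow> a - b \<in> weyl_ideal"

lemma weyl_ideal_mult_left: "a \<in> weyl_ideal \<Longrightarrow> u * a \<in> weyl_ideal"
  using weyl_ideal.mult[of a u 1] by simp

lemma weyl_ideal_mult_right: "a \<in> weyl_ideal \<Longrightarrow> a * v \<in> weyl_ideal"
  using weyl_ideal.mult[of a 1 v] by simp

lemma weyl_ideal_uminus: "a \<in> weyl_ideal \<Longrightarrow> - a \<in> weyl_ideal"
  using weyl_ideal_mult_left[of a "- 1"] by simp

lemma equivp_weyl_rel: "equivp (weyl_rel :: (word \<Rightarrow>\<^sub>0 'f::field_char_0) \<Rightarrow> _)"
proof (rule equivpI)
  show "reflp (weyl_rel :: (word \<Rightarrow>\<^sub>0 'f) \<Rightarrow> _)"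
    by (rule reflpI) (simp add: weyl_rel_def weyl_ideal.zero)
  show "symp (weyl_rel :: (word \<Rightarrow>\<^sub>0 'f) \<Rightarrow> _)"
  proof (rule sympI)
    fix a b :: "word \<Rightarrow>\<^sub>0 'f"
    assume "weyl_rel a b"
    then have "- (a - b) \<in> weyl_ideal"
      unfolding weyl_rel_def by (rule weyl_ideal_uminus)
    then show "weyl_rel b a" by (simp add: weyl_rel_def)
  qed
  show "transp (weyl_rel :: (word \<Rightarrow>\<^sub>0 'f) \<Rightarrow> _)"
  proof (rule transpI)
    fix a b c :: "word \<Rightarrow>\<^sub>0 'f"
    assume "weyl_rel a b" "weyl_rel b c"
    then have "(a - b) + (b - c) \<in> weyl_ideal"
      unfolding weyl_rel_def by (rule weyl_ideal.add)
    then show "weyl_rel a c" by (simp add: weyl_rel_def)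
  qed
qed

quotient_type (overloaded) 'f weyl = "word \<Rightarrow>\<^sub>0 ('f::field_char_0)" / weyl_rel
  by (rule equivp_weyl_rel)

text \<open>The representation on polynomials in one variable by \<open>p \<mapsto> X\<close> and \<open>q \<mapsto> - d/dX\<close> shows that the
  quotient is nonzero, and later that the \<open>p\<^sup>i q\<^sup>j\<close> are independent.\<close>

fun act_gen :: "gen \<Rightarrow> 'f::field_char_0 poly \<Rightarrow> 'f poly" where
  "act_gen Gen_p h = pCons 0 h"
| "act_gen Gen_q h = - pderiv h"

definition act_word :: "word \<Rightarrow> 'f::field_char_0 poly \<Rightarrow> 'f poly"
  where "act_word w h = foldr act_gen (letters w) h"

definition act :: "(word \<Rightarrow>\<^sub>0 'f::field_char_0) \<Rightarrow> 'f poly \<Rightarrow> 'f poly"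
  where "act a h = (\<Sum>w\<in>Poly_Mapping.keys a. smult (Poly_Mapping.lookup a w) (act_word w h))"

lemma act_gen_linear:
  "act_gen g (h + k) = act_gen g h + act_gen g k"
  "act_gen g (smult c h) = smult c (act_gen g h)"
  "act_gen g 0 = 0"
  by (cases g; simp add: pderiv_add pderiv_smult)+

lemma act_word_linear:
  fixes h k :: "'f::field_char_0 poly"
  shows "act_word w (h + k) = act_word w h + act_word w k"
  "act_word w (smult c h) = smult c (act_word w h)"
  "act_word w (0 :: 'f poly) = 0"
proof -
  have "foldr act_gen gs (h + k) = foldr act_gen gs h + foldr act_gen gs k"
    "foldr act_gen gs (smult c h) = smult c (foldr act_gen gs h)"
    "foldr act_gen gs 0 = (0 :: 'f poly)" for gs
    by (induction gs) (simp_all add: act_gen_linear)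
  then show "act_word w (h + k) = act_word w h + act_word w k"
    "act_word w (smult c h) = smult c (act_word w h)" "act_word w (0 :: 'f poly) = 0"
    by (simp_all add: act_word_def)
qed

lemma act_word_plus: "act_word (u + v) h = act_word u (act_word v h)"
  by (simp add: act_word_def plus_word_def)

lemma act_single: "act (Poly_Mapping.single w c) h = smult c (act_word w h)"
  by (simp add: act_def)

lemma act_add: "act (a + b) h = act a h + act b h"
  unfolding act_def
  by (rule setsum_keys_plus_distrib) (simp_all add: smult_add_left)

lemma act_zero: "act 0 h = 0"
  by (simp add: act_def)

lemma act_uminus: "act (- a) h = - act a h"
  using act_add[of a "- a" h] by (simp add: act_zero eq_neg_iff_add_eq_0 add.commute)

lemma act_diff: "act (a - b) h = act a h - act b h"
  using act_add[of a "- b" h] by (simp add: act_uminus)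

lemma free_induct [case_names single add]:
  fixes a :: "word \<Rightarrow>\<^sub>0 'f::field_char_0"
  assumes single: "\<And>w c. Q (Poly_Mapping.single w c)"
    and add: "\<And>a b. Q a \<Longrightarrow> Q b \<Longrightarrow> Q (a + b)"
  shows "Q a"
proof -
  have "a = (\<Sum>w\<in>Poly_Mapping.keys a. Poly_Mapping.single w (Poly_Mapping.lookup a w))"
  proof (rule poly_mapping_eqI)
    fix k
    have "Poly_Mapping.lookup (\<Sum>w\<in>Poly_Mapping.keys a. Poly_Mapping.single w (Poly_Mapping.lookup a w)) k
      = (\<Sum>w\<in>Poly_Mapping.keys a. if w = k then Poly_Mapping.lookup a w else 0)"
      by (simp add: lookup_sum lookup_single when_def)
    also have "\<dots> = Poly_Mapping.lookup a k"
      by (simp add: in_keys_iff)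
    finally show "Poly_Mapping.lookup a k = Poly_Mapping.lookup
      (\<Sum>w\<in>Poly_Mapping.keys a. Poly_Mapping.single w (Poly_Mapping.lookup a w)) k" ..
  qed
  moreover have "Q (\<Sum>w\<in>S. Poly_Mapping.single w (f w))" for S and f :: "word \<Rightarrow> 'f"
    using single[of 0 0]
    by (induction S rule: infinite_finite_induct) (simp_all add: single add)
  ultimately show ?thesis by metis
qed

lemma act_linear: "act a (h + k) = act a h + act a k" "act a (smult c h) = smult c (act a h)"
  "act a 0 = 0"
  by (induction a rule: free_induct;
      simp add: act_single act_add act_word_linear smult_add_right algebra_simps)+

lemma act_mult: "act (a * b) h = act a (act b h)"
proof (induction a rule: free_induct)
  case (single u c)
  show ?case
  proof (induction b rule: free_induct)
    case (single v d)
    show ?case by (simp add: mult_single act_single act_word_plus act_word_linear)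
  next
    case (add b b')
    then show ?case by (simp add: distrib_left act_add act_linear)
  qed
next
  case (add a a')
  then show ?case by (simp add: distrib_right act_add)
qed

lemma act_one: "act 1 h = h"
  unfolding single_one[symmetric] act_single by (simp add: act_word_def zero_word_def)

lemma act_free_gen: "act (free_gen g) h = act_gen g h"
  by (simp add: free_gen_def act_single act_word_def)

lemma act_weyl_ideal: "a \<in> weyl_ideal \<Longrightarrow> act a h = 0"
proof (induction arbitrary: h rule: weyl_ideal.induct)
  case relation
  show ?case by (simp add: act_diff act_mult act_free_gen act_one pderiv_pCons pderiv_minus)
qed (simp_all add: act_zero act_add act_mult act_linear)

lemma one_notin_weyl_ideal: "1 \<notin> weyl_ideal"
  using act_weyl_ideal[of 1 1] by (auto simp: act_one)

instantiation weyl :: (field_char_0) ring_1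
begin

lift_definition zero_weyl :: "'a weyl" is 0 .
lift_definition one_weyl :: "'a weyl" is 1 .
lift_definition plus_weyl :: "'a weyl \<Rightarrow> 'a weyl \<Rightarrow> 'a weyl" is "(+)"
  unfolding weyl_rel_def by (metis weyl_ideal.add add_diff_add)
lift_definition uminus_weyl :: "'a weyl \<Rightarrow> 'a weyl" is uminus
  unfolding weyl_rel_def by (metis weyl_ideal_uminus minus_diff_minus)
lift_definition minus_weyl :: "'a weyl \<Rightarrow> 'a weyl \<Rightarrow> 'a weyl" is "(-)"
  unfolding weyl_rel_def
proof -
  fix a a' b b' :: "word \<Rightarrow>\<^sub>0 'a"
  assume "a - a' \<in> weyl_ideal" "b - b' \<in> weyl_ideal"
  then have "(a - a') + - (b - b') \<in> weyl_ideal"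
    by (intro weyl_ideal.add weyl_ideal_uminus)
  then show "a - b - (a' - b') \<in> weyl_ideal" by (simp add: algebra_simps)
qed
lift_definition times_weyl :: "'a weyl \<Rightarrow> 'a weyl \<Rightarrow> 'a weyl" is "(*)"
  unfolding weyl_rel_def
proof -
  fix a a' b b' :: "word \<Rightarrow>\<^sub>0 'a"
  assume "a - a' \<in> weyl_ideal" "b - b' \<in> weyl_ideal"
  then have "(a - a') * b + a' * (b - b') \<in> weyl_ideal"
    by (intro weyl_ideal.add weyl_ideal_mult_left weyl_ideal_mult_right)
  then show "a * b - a' * b' \<in> weyl_ideal" by (simp add: algebra_simps)
qed

instance
proof
  fix a b c :: "'a weyl"
  have refl: "weyl_rel x x" for x :: "word \<Rightarrow>\<^sub>0 'a"
    by (simp add: weyl_rel_def weyl_ideal.zero)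
  show "a * b * c = a * (b * c)" by transfer (simp add: mult.assoc refl)
  show "a + b + c = a + (b + c)" by transfer (simp add: add.assoc refl)
  show "a + b = b + a" by transfer (simp add: add.commute refl)
  show "1 * a = a" by transfer (simp add: refl)
  show "a * 1 = a" by transfer (simp add: refl)
  show "0 + a = a" by transfer (simp add: refl)
  show "- a + a = 0" by transfer (simp add: refl)
  show "a - b = a + - b" by transfer (simp add: refl)
  show "(a + b) * c = a * c + b * c" by transfer (simp add: distrib_right refl)
  show "a * (b + c) = a * b + a * c" by transfer (simp add: distrib_left refl)
  show "(0::'a weyl) \<noteq> 1"
    using weyl_ideal_uminus[of "- 1 :: word \<Rightarrow>\<^sub>0 'a"] one_notin_weyl_ideal[where 'a = 'a]
    unfolding zero_weyl_def one_weyl_def weyl.abs_eq_iff by (auto simp: weyl_rel_def)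
qed

end

lift_definition weyl_p :: "'f::field_char_0 weyl" is "free_gen Gen_p" .
lift_definition weyl_q :: "'f::field_char_0 weyl" is "free_gen Gen_q" .

lift_definition weyl_scale :: "'f::field_char_0 \<Rightarrow> 'f weyl \<Rightarrow> 'f weyl" is "\<lambda>c a. free_const c * a"
  unfolding weyl_rel_def by (metis weyl_ideal_mult_left right_diff_distrib)

lemma weyl_commutator: "weyl_p * weyl_q - weyl_q * weyl_p = (1 :: 'f::field_char_0 weyl)"
  by transfer (simp add: weyl_rel_def weyl_ideal.relation)

lemma free_const_hom:
  "free_const (c + d) = free_const c + free_const d"
  "free_const (c * d) = free_const c * free_const d"
  "free_const 1 = 1"
  by (simp_all add: free_const_def single_add mult_single)

lemma free_const_central: "a * free_const c = free_const c * (a :: word \<Rightarrow>\<^sub>0 'f::field_char_0)"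
  by (induction a rule: free_induct)
    (simp_all add: free_const_def mult_single mult.commute distrib_left distrib_right)

lemma weyl_scale_mult_left: "weyl_scale c a * b = weyl_scale c (a * b)"
  by transfer (simp add: mult.assoc weyl_rel_def weyl_ideal.zero)

lemma weyl_scale_mult_right: "a * weyl_scale c b = weyl_scale c (a * b)"
  by transfer (simp add: weyl_rel_def weyl_ideal.zero free_const_central flip: mult.assoc)

global_interpretation weyl: vector_space "weyl_scale :: 'f::field_char_0 \<Rightarrow> 'f weyl \<Rightarrow> 'f weyl"
proof
  fix c d :: 'f and x y :: "'f weyl"
  have refl: "weyl_rel a a" for a :: "word \<Rightarrow>\<^sub>0 'f"
    by (simp add: weyl_rel_def weyl_ideal.zero)
  show "weyl_scale c (x + y) = weyl_scale c x + weyl_scale c y"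
    by transfer (simp add: distrib_left refl)
  show "weyl_scale (c + d) x = weyl_scale c x + weyl_scale d x"
    by transfer (simp add: free_const_hom distrib_right refl)
  show "weyl_scale c (weyl_scale d x) = weyl_scale (c * d) x"
    by transfer (simp add: free_const_hom mult.assoc refl)
  show "weyl_scale 1 x = x"
    by transfer (simp add: free_const_hom refl)
qed

section \<open>The basis of the monomials\<close>

definition weyl_mono :: "nat \<Rightarrow> nat \<Rightarrow> 'f::field_char_0 weyl"
  where "weyl_mono i j = weyl_p ^ i * weyl_q ^ j"

definition weyl_basis :: "'f::field_char_0 weyl set"
  where "weyl_basis = {weyl_mono i j | i j. True}"

lift_definition weyl_act :: "'f::field_char_0 weyl \<Rightarrow> 'f poly \<Rightarrow> 'f poly" is act
proof -
  fix a b :: "word \<Rightarrow>\<^sub>0 'f"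
  assume "weyl_rel a b"
  then show "act a = act b"
    using act_weyl_ideal[of "a - b"] by (auto simp: weyl_rel_def act_diff fun_eq_iff)
qed

lemma weyl_act_simps:
  "weyl_act (x + y) h = weyl_act x h + weyl_act y h"
  "weyl_act (x * y) h = weyl_act x (weyl_act y h)"
  "weyl_act 0 h = 0" "weyl_act 1 h = h"
  "weyl_act (weyl_scale c x) h = smult c (weyl_act x h)"
  "weyl_act weyl_p h = pCons 0 h" "weyl_act weyl_q h = - pderiv h"
  by (transfer; simp add: act_add act_mult act_zero act_one act_free_gen free_const_def act_single
      act_word_def zero_word_def)+

lemma weyl_act_sum: "weyl_act (sum f S) h = (\<Sum>x\<in>S. weyl_act (f x) h)"
  by (induction S rule: infinite_finite_induct) (simp_all add: weyl_act_simps)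

lemma weyl_act_mono:
  "weyl_act (weyl_mono i j) h = monom ((- 1) ^ j) i * (pderiv ^^ j) h"
proof -
  have q: "weyl_act (weyl_q ^ j) h = smult ((- 1) ^ j) ((pderiv ^^ j) h)" for j
    by (induction j) (simp_all add: weyl_act_simps pderiv_smult)
  have p: "weyl_act (weyl_p ^ i) h = monom 1 i * h" for i and h :: "'a poly"
    by (induction i arbitrary: h)
      (simp_all add: weyl_act_simps monom_Suc)
  show ?thesis
    by (simp add: weyl_mono_def weyl_act_simps q p smult_monom flip: mult_smult_left)
qed

lemma pderiv_funpow_monom:
  "(pderiv ^^ j) (monom (1 :: 'f::field_char_0) n) =
    (if j \<le> n then monom (fact n / fact (n - j)) (n - j) else 0)"
proof (induction j)
  case (Suc j)
  show ?case
  proof (cases "j < n")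
    case True
    then obtain m where m: "n - j = Suc m" "n - Suc j = m" by (metis Suc_diff_Suc)
    have f: "(fact n :: 'f) / fact m = of_nat (Suc m) * (fact n / fact (Suc m))"
      unfolding fact_Suc using of_nat_neq_0[of m, where 'a = 'f]
      by (simp del: of_nat_Suc)
    have "(pderiv ^^ Suc j) (monom (1 :: 'f) n) = pderiv (monom (fact n / fact (Suc m)) (Suc m))"
      using Suc True by (simp only: funpow.simps comp_apply m less_imp_le if_True)
    also have "\<dots> = monom (fact n / fact m) m"
      by (simp only: pderiv_monom f diff_Suc_1)
    finally show ?thesis using True by (simp only: m Suc_le_eq if_True)
  next
    case False
    then show ?thesis using Suc
      by (cases "j = n") (simp_all add: pderiv_monom)
  qed
qed simp

lemma weyl_mono_relation:
  fixes c :: "nat \<times> nat \<Rightarrow> 'f::field_char_0"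
  assumes S: "finite S"
    and rel: "(\<Sum>(i, j)\<in>S. weyl_scale (c (i, j)) (weyl_mono i j)) = 0"
  shows "(i, j) \<in> S \<Longrightarrow> c (i, j) = 0"
proof (induction j arbitrary: i rule: less_induct)
  case (less j)
  let ?h = "monom 1 j :: 'f poly"
  let ?t = "\<lambda>(i', j'). smult (c (i', j')) (monom ((- 1) ^ j') i' * (pderiv ^^ j') ?h)"
  have t: "coeff (?t z) i = (if z = (i, j) then c (i, j) * (- 1) ^ j * fact j else 0)"
    if z: "z \<in> S" for z
  proof -
    obtain i' j' where [simp]: "z = (i', j')" by force
    consider "j' < j" | "j' = j" | "j < j'" by linarith
    then show ?thesis
    proof cases
      case 1
      then show ?thesis using less.IH[of j' i'] z by auto
    next
      case 2
      then show ?thesis by (simp add: pderiv_funpow_monom mult_monom smult_monom)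
    next
      case 3
      then show ?thesis by (simp add: pderiv_funpow_monom)
    qed
  qed
  have "0 = weyl_act (\<Sum>(i, j)\<in>S. weyl_scale (c (i, j)) (weyl_mono i j)) ?h"
    by (simp add: rel weyl_act_simps)
  also have "\<dots> = (\<Sum>z\<in>S. ?t z)"
    by (simp add: weyl_act_sum weyl_act_simps weyl_act_mono case_prod_unfold)
  finally have "0 = coeff (\<Sum>z\<in>S. ?t z) i" by simp
  also have "\<dots> = (\<Sum>z\<in>S. if z = (i, j) then c (i, j) * (- 1) ^ j * fact j else 0)"
    unfolding coeff_sum by (rule sum.cong) (use t in auto)
  also have "\<dots> = c (i, j) * (- 1) ^ j * fact j"
    using S less.prems by simp
  finally show ?case by simp
qed

lemma weyl_mono_inj: "weyl_mono i j = (weyl_mono i' j' :: 'f::field_char_0 weyl) \<longleftrightarrow> i = i' \<and> j = j'"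
proof
  assume eq: "weyl_mono i j = (weyl_mono i' j' :: 'f weyl)"
  show "i = i' \<and> j = j'"
  proof (rule ccontr)
    assume "\<not> (i = i' \<and> j = j')"
    then have ne: "(i, j) \<noteq> (i', j')" by simp
    define c :: "nat \<times> nat \<Rightarrow> 'f" where "c z = (if z = (i, j) then 1 else - 1)" for z
    have c: "c (i, j) = 1" "c (i', j') = - 1" using ne by (auto simp: c_def)
    have "(\<Sum>(a, b)\<in>{(i, j), (i', j')}. weyl_scale (c (a, b)) (weyl_mono a b)) =
        weyl_scale 1 (weyl_mono i j) + weyl_scale (- 1) (weyl_mono i' j')"
      using ne by (simp add: c)
    also have "\<dots> = 0"
      unfolding eq weyl.scale_minus_left by simp
    finally have "c (i, j) = 0"
      using weyl_mono_relation[of "{(i, j), (i', j')}" c i j] by simp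
    with c show False by simp
  qed
qed simp

lemma inj_weyl_mono: "inj (\<lambda>z. weyl_mono (fst z) (snd z) :: 'f::field_char_0 weyl)"
  by (auto simp: inj_def weyl_mono_inj)

lemma weyl_basis_independent: "\<not> weyl.dependent (weyl_basis :: 'f::field_char_0 weyl set)"
  unfolding weyl.independent_explicit_module
proof (intro allI impI)
  fix T :: "'f weyl set" and u :: "'f weyl \<Rightarrow> 'f" and v
  assume T: "finite T" "T \<subseteq> weyl_basis" "(\<Sum>v\<in>T. weyl_scale (u v) v) = 0" "v \<in> T"
  let ?m = "\<lambda>z. weyl_mono (fst z) (snd z) :: 'f weyl"
  define S where "S = ?m -` T"
  have TS: "T = ?m ` S"
  proof -
    have "v \<in> ?m ` S" if "v \<in> T" for v
    proof -
      obtain i j where "v = weyl_mono i j" 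
        using T(2) \<open>v \<in> T\<close> unfolding weyl_basis_def by blast
      then show ?thesis using that by (auto simp: S_def intro: image_eqI[of _ _ "(i, j)"])
    qed
    then show ?thesis by (auto simp: S_def)
  qed
  have S: "finite S" unfolding S_def using T(1) inj_weyl_mono by (rule finite_vimageI)
  have "(\<Sum>v\<in>T. weyl_scale (u v) v) = (\<Sum>(i, j)\<in>S. weyl_scale (u (?m (i, j))) (weyl_mono i j))"
    unfolding TS by (subst sum.reindex) (auto intro: inj_on_subset[OF inj_weyl_mono] simp: case_prod_unfold)
  then show "u v = 0"
    using weyl_mono_relation[OF S, of "\<lambda>z. u (?m z)"] T(3,4) by (auto simp: TS)
qed

lemma weyl_q_p_power:
  "weyl_q * weyl_p ^ i = weyl_p ^ i * weyl_q - of_nat i * (weyl_p ^ (i - 1) :: 'f::field_char_0 weyl)"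
proof (induction i)
  case (Suc i)
  have qp: "weyl_q * weyl_p = weyl_p * weyl_q - (1 :: 'f weyl)"
    using weyl_commutator[where 'f = 'f] by (simp add: algebra_simps)
  have "weyl_q * weyl_p ^ Suc i = (weyl_q * weyl_p ^ i) * (weyl_p :: 'f weyl)"
    by (simp add: power_commutes mult.assoc)
  also have "\<dots> = weyl_p ^ i * (weyl_q * weyl_p) - of_nat i * (weyl_p ^ (i - 1) * weyl_p)"
    by (simp add: Suc left_diff_distrib mult.assoc)
  also have "\<dots> = weyl_p ^ Suc i * weyl_q - weyl_p ^ i - of_nat i * (weyl_p ^ (i - 1) * weyl_p)"
    by (simp add: qp right_diff_distrib power_commutes flip: mult.assoc)
  also have "of_nat i * (weyl_p ^ (i - 1) * weyl_p) = of_nat i * (weyl_p ^ i :: 'f weyl)"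
    by (cases i) (simp_all add: power_commutes)
  finally show ?case by (simp add: algebra_simps)
qed simp

lemma weyl_of_nat_mult: "of_nat n * x = weyl_scale (of_nat n) (x :: 'f::field_char_0 weyl)"
  by (induction n) (simp_all add: distrib_right weyl.scale_left_distrib)

lemma weyl_basis_span: "weyl.span weyl_basis = (UNIV :: 'f::field_char_0 weyl set)"
proof -
  let ?S = "weyl.span weyl_basis :: 'f weyl set"
  have mono: "weyl_mono i j \<in> ?S" for i j
    by (rule weyl.span_base) (auto simp: weyl_basis_def)
  have left: "g * x \<in> ?S" if g: "\<And>i j. g * weyl_mono i j \<in> ?S" and x: "x \<in> ?S" for g x :: "'f weyl"
    using x
  proof (induction rule: weyl.span_induct_alt)
    case base
    show ?case by (simp add: weyl.span_zero)
  next
    case (step c b y)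
    then have "g * b \<in> ?S" using g by (auto simp: weyl_basis_def)
    with step show ?case
      by (simp add: distrib_left weyl_scale_mult_right weyl.span_add weyl.span_scale)
  qed
  have "weyl_p * weyl_mono i j = (weyl_mono (Suc i) j :: 'f weyl)" for i j
    by (simp add: weyl_mono_def mult.assoc)
  then have p: "weyl_p * x \<in> ?S" if "x \<in> ?S" for x
    using left[of weyl_p x] that mono by simp
  have "weyl_q * weyl_mono i j =
      weyl_mono i (Suc j) - weyl_scale (of_nat i) (weyl_mono (i - 1) j :: 'f weyl)" for i j
  proof -
    have "weyl_q * weyl_mono i j = (weyl_q * weyl_p ^ i) * (weyl_q ^ j :: 'f weyl)"
      by (simp add: weyl_mono_def mult.assoc)
    then show ?thesis
      by (simp add: weyl_q_p_power left_diff_distrib weyl_of_nat_mult weyl_scale_mult_left)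
        (simp add: weyl_mono_def mult.assoc)
  qed
  then have q: "weyl_q * x \<in> ?S" if "x \<in> ?S" for x
    using left[of weyl_q x] that mono by (simp add: weyl.span_diff weyl.span_scale)
  have "abs_weyl a \<in> ?S" for a
  proof (induction a rule: free_induct)
    case (add a b)
    then show ?case by (simp add: weyl.span_add flip: plus_weyl.abs_eq)
  next
    case (single w c)
    have word: "abs_weyl (Poly_Mapping.single (Word gs) (1::'f)) \<in> ?S" for gs
    proof (induction gs)
      case Nil
      have "abs_weyl (Poly_Mapping.single (Word []) (1::'f)) = weyl_mono 0 0"
        by (simp add: weyl_mono_def flip: zero_word_def one_weyl.abs_eq)
      then show ?case using mono by simp
    next
      case (Cons g gs)
      have "Poly_Mapping.single (Word (g # gs)) (1::'f) = free_gen g * Poly_Mapping.single (Word gs) 1"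
        by (simp add: free_gen_def mult_single plus_word_def)
      then have "abs_weyl (Poly_Mapping.single (Word (g # gs)) (1::'f)) =
          (case g of Gen_p \<Rightarrow> weyl_p | Gen_q \<Rightarrow> weyl_q) * abs_weyl (Poly_Mapping.single (Word gs) 1)"
        by (simp add: weyl_p_def weyl_q_def split: gen.split flip: times_weyl.abs_eq)
      then show ?case using Cons p q by (cases g) simp_all
    qed
    have "Poly_Mapping.single w c = free_const c * Poly_Mapping.single (Word (letters w)) 1"
      by (simp add: free_const_def mult_single)
    then have "abs_weyl (Poly_Mapping.single w c) =
        weyl_scale c (abs_weyl (Poly_Mapping.single (Word (letters w)) 1))"
      by (simp add: weyl_scale.abs_eq)
    then show ?case using word[of "letters w"] by (simp add: weyl.span_scale)
  qed
  then show ?thesis 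
    using weyl.abs_induct[of "\<lambda>x. x \<in> ?S"] by blast
qed

section \<open>Supports, edges and edge polynomials\<close>

definition weyl_coeff :: "'f::field_char_0 weyl \<Rightarrow> nat \<Rightarrow> nat \<Rightarrow> 'f"
  where "weyl_coeff x i j = weyl.representation weyl_basis x (weyl_mono i j)"

definition weyl_supp :: "'f::field_char_0 weyl \<Rightarrow> (nat \<times> nat) set"
  where "weyl_supp x = {(i, j). weyl_coeff x i j \<noteq> 0}"

definition dirs :: "(nat \<times> nat) set"
  where "dirs = {(\<rho>, \<sigma>). \<rho> > 0 \<and> \<sigma> > 0 \<and> coprime \<rho> \<sigma>}"

text \<open>The supremum is taken in the extended reals, so it is \<open>-\<infinity>\<close> for \<open>x = 0\<close>.\<close>

definition weyl_val :: "nat \<Rightarrow> nat \<Rightarrow> 'f::field_char_0 weyl \<Rightarrow> ereal"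
  where "weyl_val \<rho> \<sigma> x = (SUP (i, j)\<in>weyl_supp x. ereal (real (i * \<rho> + j * \<sigma>)))"

definition weyl_face :: "nat \<Rightarrow> nat \<Rightarrow> 'f::field_char_0 weyl \<Rightarrow> (nat \<times> nat) set"
  where "weyl_face \<rho> \<sigma> x =
    {(i, j) \<in> weyl_supp x. ereal (real (i * \<rho> + j * \<sigma>)) = weyl_val \<rho> \<sigma> x}"

text \<open>The ring \<open>F[X,Y]\<close> is represented as \<open>'f poly poly\<close>, with \<open>Y\<close> as the outer variable:
  \<open>monom (monom a i) j\<close> is \<open>a X\<^sup>i Y\<^sup>j\<close>.\<close>

definition weyl_poly :: "nat \<Rightarrow> nat \<Rightarrow> 'f::field_char_0 weyl \<Rightarrow> 'f poly poly"
  where "weyl_poly \<rho> \<sigma> x = (\<Sum>(i, j)\<in>weyl_face \<rho> \<sigma> x. monom (monom (weyl_coeff x i j) i) j)"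

text \<open>Supports are finite, so \<^const>\<open>card\<close> below counts the points correctly.\<close>

definition weyl_edges :: "'f::field_char_0 weyl \<Rightarrow> (nat \<times> nat) set set"
  where "weyl_edges x =
    {weyl_face \<rho> \<sigma> x | \<rho> \<sigma>. (\<rho>, \<sigma>) \<in> dirs \<and> card (weyl_face \<rho> \<sigma> x) > 1}"

definition weyl_solvable :: "'f::field_char_0 weyl \<Rightarrow> bool"
  where "weyl_solvable x \<longleftrightarrow> (\<exists>y. x * y - y * x = 1)"

lemma finite_weyl_supp: "finite (weyl_supp (x :: 'f::field_char_0 weyl))"
proof -
  let ?m = "\<lambda>z. weyl_mono (fst z) (snd z) :: 'f weyl"
  have "weyl_supp x = ?m -` {b. weyl.representation weyl_basis x b \<noteq> 0}"
    by (auto simp: weyl_supp_def weyl_coeff_def)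
  then show ?thesis
    using finite_vimageI[OF weyl.finite_representation inj_weyl_mono] by simp
qed

lemma weyl_expansion:
  "(\<Sum>(i, j)\<in>weyl_supp x. weyl_scale (weyl_coeff x i j) (weyl_mono i j)) = (x :: 'f::field_char_0 weyl)"
proof -
  let ?m = "\<lambda>z. weyl_mono (fst z) (snd z) :: 'f weyl"
  let ?r = "weyl.representation weyl_basis x"
  have "{b. ?r b \<noteq> 0} \<subseteq> weyl_basis"
    using weyl.representation_ne_zero by blast
  then have "b \<in> ?m ` weyl_supp x" if "?r b \<noteq> 0" for b
  proof -
    obtain i j where "b = weyl_mono i j"
      using \<open>{b. ?r b \<noteq> 0} \<subseteq> weyl_basis\<close> \<open>?r b \<noteq> 0\<close> by (auto simp: weyl_basis_def)
    then show ?thesis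
      using that by (auto simp: weyl_supp_def weyl_coeff_def intro: image_eqI[of _ _ "(i, j)"])
  qed
  then have "{b. ?r b \<noteq> 0} = ?m ` weyl_supp x"
    by (auto simp: weyl_supp_def weyl_coeff_def)
  moreover have "(\<Sum>b | ?r b \<noteq> 0. weyl_scale (?r b) b) = x"
    by (rule weyl.sum_nonzero_representation_eq)
      (simp_all add: weyl_basis_independent weyl_basis_span)
  ultimately show ?thesis
    by (simp add: sum.reindex[OF inj_on_subset[OF inj_weyl_mono]] case_prod_unfold weyl_coeff_def)
qed

end

theory Submission
  imports "HOL-Algebra.Algebraic_Closure_Type" Defs
begin

text \<open>A solvable element of the Weyl algebra has at most one edge, so the situation \<open>k \<ge> 2\<close> never arises
  and the claim on the greatest common divisor holds vacuously. The idea is that an edge of a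
  solvable element must run into a coordinate axis, in a way that leaves no room for a second edge.

  Fix a direction \<open>(\<rho>, \<sigma>)\<close> and filter the algebra by the weight \<open>i\<rho> + j\<sigma>\<close>. The associated graded ring is
  \<open>F[X,Y]\<close>, and the commutator, which lowers weights by \<open>\<rho> + \<sigma>\<close>, induces the Poisson bracket. Let
  \<open>[x,y] = 1\<close>, let \<open>x\<close> have weight \<open>n\<close> and leading form \<open>r\<close>. Consider all \<open>G\<close> for which \<open>[x,G] \<noteq> 0\<close> has a
  leading form \<open>h\<close> that Poisson commutes with \<open>r\<close>; the element \<open>y\<close> is one of them. If the leading form
  \<open>g\<close> of \<open>G\<close> also Poisson commutes with \<open>r\<close>, then \<open>g\<^sup>n\<close> is a multiple of a power of \<open>r\<close>, and subtracting
  that multiple of a power of \<open>x\<close> from \<open>G\<^sup>n\<close> yields an element of the same kind for which the difference of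
  the weights of \<open>G\<close> and \<open>[x,G]\<close> is smaller. At the minimum one therefore has \<open>{r,g} = h \<noteq> 0\<close>, while \<open>h\<^sup>n\<close>
  is a multiple of a power of \<open>r\<close> (lemma \<open>leading_form_equation\<close>).

  Setting \<open>Y = 1\<close> turns the forms into polynomials in \<open>X\<close> and the equation into one between weighted
  Wronskians. Over the algebraic closure, comparing vanishing orders shows that every root \<open>z\<close> of \<open>r\<close>
  satisfies \<open>ord g \<ge> ord h - ord r + 1\<close>; summing over the roots bounds \<open>deg g\<close> from below by
  \<open>deg h - deg r\<close> plus the number of distinct roots. If \<open>\<rho> > \<sigma>\<close>, or if the edge does not reach the
  \<open>X\<close>-axis, the weights give \<open>deg g \<le> deg h - deg r + 1\<close>, so that \<open>r = c(X - z)\<^sup>D\<close> (lemma \<open>single_root\<close>).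
  It follows that an edge with \<open>\<rho> > \<sigma>\<close> contains a point of the \<open>Y\<close>-axis and one with \<open>\<rho> < \<sigma>\<close> contains a
  point of the \<open>X\<close>-axis (lemma \<open>edge_meets_axis\<close>).

  Finally, as \<open>\<rho>/\<sigma>\<close> grows, faces move to the right and downwards. Of two edges with
  \<open>\<rho>/\<sigma> < \<rho>'/\<sigma>'\<close>, either the second one has \<open>\<rho>' > \<sigma>'\<close> and meets the \<open>Y\<close>-axis, which forces the whole first
  edge onto that axis, or the first one has \<open>\<rho> < \<sigma>\<close> and meets the \<open>X\<close>-axis, which forces the whole
  second edge onto it. Both are impossible, since an edge in a direction with positive components has
  no two points on the same axis.\<close>


section \<open>The weighted Wronskian\<close>

text \<open>If \<open>U\<close> and \<open>V\<close> are \<open>(\<rho>, \<sigma>)\<close>-homogeneous of weights \<open>a\<close> and \<open>b\<close>, then \<open>u = U(X,1)\<close> and \<open>v = V(X,1)\<close> satisfy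
  \<open>wronskian a b u v = \<sigma> {U,V}(X,1)\<close>: Euler's relation expresses the derivatives with respect to \<open>Y\<close> by
  those with respect to \<open>X\<close>. Working with this expression avoids polynomials in two variables.\<close>

definition wronskian :: "'a::field_char_0 \<Rightarrow> 'a \<Rightarrow> 'a poly \<Rightarrow> 'a poly \<Rightarrow> 'a poly"
  where "wronskian a b u v = smult b (pderiv u * v) - smult a (u * pderiv v)"

lemma pderiv_power_times: "p * pderiv (p ^ n) = smult (of_nat n) (p ^ n * pderiv p)"
  for p :: "'a::field_char_0 poly"
proof (cases n)
  case (Suc k)
  have "p * pderiv (p ^ Suc k) = smult (of_nat (Suc k)) (p ^ Suc k * pderiv p)"
    unfolding pderiv_power_Suc by (simp only: power_Suc mult_smult_left mult_smult_right mult.assoc)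
  then show ?thesis using Suc by simp
qed simp

lemma wronskian_add: "wronskian a b (u + u') v = wronskian a b u v + wronskian a b u' v" "wronskian a b u (v + v') = wronskian a b u v + wronskian a b u v'"
  by (simp_all add: wronskian_def pderiv_add algebra_simps smult_add_right)

lemma wronskian_smult: "wronskian a b (smult c u) v = smult c (wronskian a b u v)" "wronskian a b u (smult c v) = smult c (wronskian a b u v)"
  by (simp_all add: wronskian_def pderiv_smult algebra_simps smult_diff_right)

lemma wronskian_0 [simp]: "wronskian a b 0 v = 0" "wronskian a b u 0 = 0"
  by (simp_all add: wronskian_def)

lemma wronskian_mult_right: "wronskian a (b + c) u (v * w) = wronskian a b u v * w + v * wronskian a c u w"
  by (simp add: wronskian_def pderiv_mult algebra_simps smult_add_left smult_add_right smult_diff_right)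

lemma wronskian_power_right: "wronskian a (of_nat n * b) u (v ^ n) * v = smult (of_nat n) (v ^ n * wronskian a b u v)"
proof -
  have "wronskian a (of_nat n * b) u (v ^ n) * v
      = smult (of_nat n * b) (pderiv u * v ^ n * v) - smult a (u * (v * pderiv (v ^ n)))"
    by (simp add: wronskian_def left_diff_distrib mult.assoc mult.commute[of v])
  then show ?thesis
    by (simp add: pderiv_power_times wronskian_def smult_diff_right algebra_simps)
qed

lemma coeff_mult_top:
  fixes p q :: "'a::comm_semiring_0 poly"
  assumes "degree p \<le> m" "degree q \<le> n"
  shows "coeff (p * q) (m + n) = coeff p m * coeff q n"
proof -
  have "(\<Sum>i\<le>m+n. coeff p i * coeff q (m + n - i)) = (\<Sum>i\<in>{m}. coeff p i * coeff q (m + n - i))"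
  proof (intro sum.mono_neutral_right ballI)
    fix i assume i: "i \<in> {..m + n} - {m}"
    then consider "i > m" | "m + n - i > n" by force
    then show "coeff p i * coeff q (m + n - i) = 0"
      using assms by cases (simp_all add: coeff_eq_0)
  qed auto
  then show ?thesis by (simp add: coeff_mult)
qed

text \<open>The Euler operator \<open>p \<mapsto> X p'\<close> is used to compare leading coefficients because, unlike
  differentiation, it does not shift the degree, and so needs no case distinction for constants.\<close>

lemma degree_Euler: "degree (pCons 0 (pderiv p)) \<le> degree p"
  and coeff_Euler: "coeff (pCons 0 (pderiv p)) (degree p) = of_nat (degree p) * lead_coeff p"
  for p :: "'a::field_char_0 poly"
proof -
  show "degree (pCons 0 (pderiv p)) \<le> degree p"
    by (rule degree_le) (auto simp: coeff_pCons coeff_pderiv coeff_eq_0 split: nat.splits)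
  show "coeff (pCons 0 (pderiv p)) (degree p) = of_nat (degree p) * lead_coeff p"
    by (auto simp: coeff_pCons coeff_pderiv split: nat.splits)
qed

text \<open>The hypothesis says that \<open>(u/v)' = 0\<close>. Comparing leading coefficients, it forces equal degrees;
  but it is inherited by \<open>u - c v\<close>, and \<open>c\<close> can be chosen to make the degree drop.\<close>

lemma const_multiple_if_wronskian_0:
  fixes u v :: "'a::field_char_0 poly"
  assumes "u \<noteq> 0" "v \<noteq> 0" and eq: "pderiv u * v = u * pderiv v"
  shows "\<exists>c. c \<noteq> 0 \<and> u = smult c v"
proof -
  have deg: "degree a = degree b" if "a \<noteq> 0" "b \<noteq> 0" "pderiv a * b = a * pderiv b" for a b :: "'a poly"
  proof -
    have "pCons 0 (pderiv a) * b = a * pCons 0 (pderiv b)" using that by simp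
    then have "coeff (pCons 0 (pderiv a) * b) (degree a + degree b) = coeff (a * pCons 0 (pderiv b)) (degree a + degree b)"
      by simp
    then have "of_nat (degree a) * (lead_coeff a * lead_coeff b) = (of_nat (degree b) * (lead_coeff a * lead_coeff b) :: 'a)"
      by (simp only: coeff_mult_top[OF degree_Euler order_refl] coeff_mult_top[OF order_refl degree_Euler] coeff_Euler mult.assoc mult.left_commute)
    then show ?thesis using that by simp
  qed
  define c where "c = lead_coeff u / lead_coeff v"
  have c: "c \<noteq> 0" using assms by (simp add: c_def)
  have "u - smult c v = 0"
  proof (rule ccontr)
    assume n: "u - smult c v \<noteq> 0"
    have du: "degree u = degree v" using deg assms by blast
    have "pderiv (u - smult c v) * v = (u - smult c v) * pderiv v"
      using eq by (simp add: pderiv_diff pderiv_smult algebra_simps)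
    then have "degree (u - smult c v) = degree v" using deg n assms by blast
    moreover have "coeff (u - smult c v) (degree v) = 0"
      using assms du by (simp add: c_def)
    ultimately show False using n leading_coeff_0_iff by metis
  qed
  then show ?thesis using c by auto
qed

lemma proportional_powers:
  fixes u v :: "'a::field_char_0 poly"
  assumes "u \<noteq> 0" "v \<noteq> 0" "wronskian (of_nat a) (of_nat b) u v = 0"
  shows "\<exists>c. c \<noteq> 0 \<and> v ^ a = smult c (u ^ b)"
proof (rule const_multiple_if_wronskian_0)
  have "(pderiv (v ^ a) * u ^ b - v ^ a * pderiv (u ^ b)) * (u * v)
      = (v * pderiv (v ^ a)) * (u ^ b * u) - (v ^ a * v) * (u * pderiv (u ^ b))"
    by (simp add: algebra_simps)
  also have "\<dots> = - (v ^ a * u ^ b * wronskian (of_nat a) (of_nat b) u v)"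
    unfolding pderiv_power_times wronskian_def by (simp add: algebra_simps)
  finally show "pderiv (v ^ a) * u ^ b = v ^ a * pderiv (u ^ b)"
    using assms by simp
qed (use assms in auto)

text \<open>After multiplication by \<open>X - z\<close>, both products in the Wronskian are divisible by \<open>(X - z)\<close> to the power
  \<open>ord u + ord v\<close>, and the hypothesis says exactly that the coefficients there do not cancel. The next
  lemma is the analogue at infinity.\<close>

lemma order_wronskian:
  fixes u v :: "'a::field_char_0 poly"
  assumes nz: "u \<noteq> 0" "v \<noteq> 0" "wronskian a b u v \<noteq> 0"
    and ne: "b * of_nat (order z u) \<noteq> a * of_nat (order z v)"
  shows "order z (wronskian a b u v) + 1 = order z u + order z v"
proof -
  define L where "L = [:-z, 1:]"
  obtain u1 where u: "u = L ^ order z u * u1" "\<not> L dvd u1"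
    using order_decomp[OF nz(1)] by (auto simp: L_def)
  obtain v1 where v: "v = L ^ order z v * v1" "\<not> L dvd v1"
    using order_decomp[OF nz(2)] by (auto simp: L_def)
  define e k where "e = order z u" and "k = order z v"
  have L': "L * pderiv (L ^ n) = smult (of_nat n) (L ^ n)" for n
    using pderiv_power_times[of L n] by (simp add: L_def pderiv_pCons mult.commute)
  have Ld: "L * pderiv (L ^ n * w) = L ^ n * (smult (of_nat n) w + L * pderiv w)" for n w
  proof -
    have "L * pderiv (L ^ n * w) = (L * pderiv (L ^ n)) * w + L ^ n * (L * pderiv w)"
      by (simp add: pderiv_mult algebra_simps)
    then show ?thesis by (simp add: L' algebra_simps)
  qed
  define w where "w = smult b ((smult (of_nat e) u1 + L * pderiv u1) * v1)
     - smult a (u1 * (smult (of_nat k) v1 + L * pderiv v1))"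
  have "L * wronskian a b u v = smult b ((L * pderiv u) * v) - smult a (u * (L * pderiv v))"
    by (simp add: wronskian_def algebra_simps)
  also have "\<dots> = L ^ (e + k) * w"
    unfolding u(1)[folded e_def] v(1)[folded k_def] Ld w_def
    by (simp add: power_add algebra_simps smult_diff_right)
  finally have eq: "L * wronskian a b u v = L ^ (e + k) * w" .
  have "poly L z = 0" "poly u1 z \<noteq> 0" "poly v1 z \<noteq> 0"
    using u(2) v(2) by (auto simp: L_def poly_eq_0_iff_dvd)
  then have pw: "poly w z \<noteq> 0" using ne by (simp add: w_def e_def k_def algebra_simps)
  have wn: "w \<noteq> 0" using pw by auto
  have Ln: "L \<noteq> 0" by (simp add: L_def)
  have "order z (L * wronskian a b u v) = 1 + order z (wronskian a b u v)"
    using order_mult[of L "wronskian a b u v" z] Ln nz order_power_n_n[of z 1, folded L_def] by simp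
  moreover have "order z (L ^ (e + k) * w) = e + k"
    using order_mult[of "L ^ (e + k)" w z] Ln wn pw order_power_n_n[of z "e + k", folded L_def]
    by (simp add: order_0I)
  ultimately show ?thesis using eq by (simp add: e_def k_def)
qed

lemma degree_wronskian:
  fixes u v :: "'a::field_char_0 poly"
  assumes nz: "u \<noteq> 0" "v \<noteq> 0"
    and ne: "b * of_nat (degree u) \<noteq> a * of_nat (degree v)"
  shows "degree u + degree v \<le> degree (wronskian a b u v) + 1"
proof -
  have "pCons 0 (wronskian a b u v) = smult b (pCons 0 (pderiv u) * v) - smult a (u * pCons 0 (pderiv v))"
    by (simp add: wronskian_def algebra_simps)
  then have "coeff (pCons 0 (wronskian a b u v)) (degree u + degree v)
      = (b * of_nat (degree u) - a * of_nat (degree v)) * (lead_coeff u * lead_coeff v)"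
    by (simp only: coeff_diff coeff_smult coeff_mult_top[OF degree_Euler order_refl] coeff_mult_top[OF order_refl degree_Euler] coeff_Euler)
       (simp add: algebra_simps)
  then have "coeff (pCons 0 (wronskian a b u v)) (degree u + degree v) \<noteq> 0"
    using nz ne by simp
  then have "degree u + degree v \<le> degree (pCons 0 (wronskian a b u v))" by (rule le_degree)
  then show ?thesis by (metis add.commute degree_pCons_le le_trans plus_1_eq_Suc)
qed

section \<open>Solutions of the leading form equation\<close>

lemma sum_order_eq_degree:
  fixes p :: "'a::alg_closed_field poly"
  assumes "p \<noteq> 0"
  shows "(\<Sum>z | poly p z = 0. order z p) = degree p"
proof -
  obtain A where A: "size A = degree p" "p = smult (lead_coeff p) (\<Prod>x\<in>#A. [:-x, 1:])"
    using alg_closed_imp_factorization[OF assms] by blast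
  have "proots (\<Prod>x\<in>#A. [:-x, 1:]) = A"
  proof (induction A)
    case (add x A)
    have "(\<Prod>x\<in>#A. [:-x, 1:]) \<noteq> 0" by (auto simp: prod_mset_zero_iff)
    then show ?case using add proots_mult[of "[:-x, 1:]" "\<Prod>x\<in>#A. [:-x, 1:]"]
      by (simp del: mult_pCons_left)
  qed simp
  then have "proots p = A"
    using assms by (subst A(2)) simp
  then have "size (proots p) = degree p" using A by simp
  then show ?thesis
    using assms by (simp add: size_multiset_overloaded_eq)
qed

lemma order_power_eq: "p \<noteq> 0 \<Longrightarrow> order z (p ^ n) = n * order z p" for p :: "'a::idom poly"
  by (induction n) (simp_all add: order_mult)

text \<open>At each root \<open>z\<close> of \<open>r\<close> the order of \<open>g\<close> exceeds that of \<open>h\<close> minus that of \<open>r\<close>: either because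
  \<open>order_wronskian\<close> computes the difference, or because in the case of cancellation the orders of \<open>g\<close> and \<open>h\<close>
  are \<open>d/n\<close> and \<open>m/n\<close> times that of \<open>r\<close>, where \<open>m < n + d\<close>. Hence \<open>deg g\<close> is at least \<open>deg h - deg r\<close> plus
  the number of distinct roots, and the bound on \<open>deg g\<close> leaves room for one root only.\<close>

lemma single_root:
  fixes r g h :: "'a::{alg_closed_field,field_char_0} poly"
  assumes nz: "r \<noteq> 0" "g \<noteq> 0" "h \<noteq> 0" and n: "n > 0"
    and dm: "int m < int n + int d"
    and wronskian: "wronskian (of_nat n) (of_nat d) r g = h"
    and h: "h ^ n = smult c (r ^ m)" "c \<noteq> 0"
    and deg: "degree g + degree r \<le> degree h + 1"
    and D: "degree r > 0"
  shows "\<exists>z. r = smult (lead_coeff r) ([:- z, 1:] ^ degree r)"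
proof -
  let ?Z = "{z. poly r z = 0}"
  have fin: "finite ?Z" using poly_roots_finite[OF nz(1)] .
  have o: "n * order z h = m * order z r" for z
    using arg_cong[OF h(1), of "order z"] nz h(2) by (simp add: order_power_eq order_smult)
  have dh: "n * degree h = m * degree r"
    using arg_cong[OF h(1), of degree] nz h(2) by (simp add: degree_power_eq)
  have loc: "order z h + 1 \<le> order z g + order z r" if "z \<in> ?Z" for z
  proof (cases "d * order z r = n * order z g")
    case False
    then have "of_nat d * of_nat (order z r) \<noteq> (of_nat n * of_nat (order z g) :: 'a)"
      by (metis of_nat_eq_iff of_nat_mult)
    then show ?thesis using order_wronskian[of r g "of_nat n" "of_nat d" z] wronskian nz by simp
  next
    case True
    have e: "order z r > 0" using that nz by (simp add: order_gt_0_iff)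
    have "n * order z h = m * order z r" by (rule o)
    also have "\<dots> < (n + d) * order z r" using dm e by simp
    also have "\<dots> = n * (order z g + order z r)" using True by (simp add: algebra_simps)
    finally show ?thesis by simp
  qed
  have sr: "(\<Sum>z\<in>?Z. order z r) = degree r" by (rule sum_order_eq_degree[OF nz(1)])
  have sh: "(\<Sum>z\<in>?Z. order z h) = degree h"
  proof -
    have "n * (\<Sum>z\<in>?Z. order z h) = n * degree h"
      by (simp only: sum_distrib_left o dh flip: sr)
    then show ?thesis using n by (metis mult_cancel1 not_gr_zero)
  qed
  have sg: "(\<Sum>z\<in>?Z. order z g) \<le> degree g"
  proof -
    have "(\<Sum>z\<in>?Z. order z g) = (\<Sum>z\<in>{z\<in>?Z. poly g z = 0}. order z g)"
      using fin by (intro sum.mono_neutral_right) (auto simp: order_0I)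
    also have "\<dots> \<le> (\<Sum>z | poly g z = 0. order z g)"
      using poly_roots_finite[OF nz(2)] by (intro sum_mono2) auto
    also have "\<dots> \<le> degree g" using sum_order_le_degree[OF nz(2)] .
    finally show ?thesis .
  qed
  have "(\<Sum>z\<in>?Z. order z h + 1) \<le> (\<Sum>z\<in>?Z. order z g + order z r)"
    by (intro sum_mono loc)
  then have "degree h + card ?Z \<le> degree g + degree r"
    using sg by (simp only: sum.distrib sr sh card_eq_sum)
  then have "card ?Z \<le> 1" using deg by simp
  moreover have "?Z \<noteq> {}" using alg_closed_imp_poly_has_root[OF D] by auto
  then have "card ?Z > 0" using fin by (simp only: card_gt_0_iff) simp
  ultimately have "card ?Z = 1" by linarith
  then obtain z where Z: "?Z = {z}" by (rule card_1_singletonE)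
  have "order z r = degree r" using sr unfolding Z by simp
  then have "[:-z, 1:] ^ degree r dvd r" using order_1[of z r] by simp
  then obtain s where s: "r = [:-z, 1:] ^ degree r * s" by auto
  then have "s \<noteq> 0" using nz by auto
  have "degree r = degree r + degree s"
    by (subst s, subst degree_mult_eq) (use \<open>s \<noteq> 0\<close> in \<open>auto simp: degree_power_eq\<close>)
  then obtain t where t: "s = [:t:]" using degree_eq_zeroE[of s] by auto
  have "lead_coeff r = lead_coeff ([:-z, 1:] ^ degree r) * lead_coeff s"
    using arg_cong[OF s, of "\<lambda>p. lead_coeff p"] by (simp only: lead_coeff_mult)
  then have "lead_coeff r = t" using t by (simp add: lead_coeff_power)
  moreover have "r = smult t ([:- z, 1:] ^ degree r)"
    by (subst s) (simp only: t mult.commute[of _ "[:t:]"] mult_pCons_left pCons_0_0 mult_zero_left add_0_right)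
  ultimately show ?thesis by metis
qed

text \<open>The lemma on single roots will be applied over the algebraic closure of the ground field; the
  following ones transport the equation there.\<close>

lemma map_to_ac_mult: "map_poly to_ac (p * q) = map_poly to_ac p * map_poly to_ac q"
  by (intro poly_eqI) (simp add: coeff_map_poly coeff_mult to_ac_sum)

lemma map_to_ac_power: "map_poly to_ac (p ^ n) = map_poly to_ac p ^ n"
  by (induction n) (simp_all add: map_to_ac_mult)

lemma map_to_ac_smult: "map_poly to_ac (smult c p) = smult (to_ac c) (map_poly to_ac p)"
  by (intro poly_eqI) (simp add: coeff_map_poly)

lemma map_to_ac_diff: "map_poly to_ac (p - q) = map_poly to_ac p - map_poly to_ac q"
  by (intro poly_eqI) (simp add: coeff_map_poly)

lemma map_to_ac_pderiv: "map_poly to_ac (pderiv p) = pderiv (map_poly to_ac p)"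
  by (intro poly_eqI) (simp add: coeff_map_poly coeff_pderiv flip: to_ac_of_nat of_nat_Suc)

lemma map_to_ac_wronskian: "map_poly to_ac (wronskian a b u v) = wronskian (to_ac a) (to_ac b) (map_poly to_ac u) (map_poly to_ac v)"
  by (simp add: wronskian_def map_to_ac_diff map_to_ac_smult map_to_ac_mult map_to_ac_pderiv)

text \<open>In \<open>c(X - z)\<^sup>D\<close> neither the constant coefficient nor the one at \<open>D - 1\<close> vanishes unless \<open>z = 0\<close>. These
  are the two coefficients about which the shape of an edge gives information.\<close>

lemma monom_if_missing_coeff:
  fixes r g h :: "'a::field_char_0 poly"
  assumes nz: "r \<noteq> 0" "g \<noteq> 0" "h \<noteq> 0" and n: "n > 0"
    and dm: "int m < int n + int d"
    and wronskian: "wronskian (of_nat n) (of_nat d) r g = h"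
    and h: "h ^ n = smult c (r ^ m)" "c \<noteq> 0"
    and deg: "degree g + degree r \<le> degree h + 1"
    and D: "degree r > 0"
    and miss: "coeff r 0 = 0 \<or> coeff r (degree r - 1) = 0"
  shows "r = monom (lead_coeff r) (degree r)"
proof -
  let ?h = "map_poly (to_ac :: 'a \<Rightarrow> 'a alg_closure)"
  have deg_ac: "degree (?h p) = degree p" for p by (intro degree_map_poly) auto
  have nz_ac: "?h p \<noteq> 0" if "p \<noteq> 0" for p using that by (simp add: map_poly_eq_0_iff)
  have "\<exists>z. ?h r = smult (lead_coeff (?h r)) ([:- z, 1:] ^ degree (?h r))"
  proof (rule single_root)
    show "wronskian (of_nat n) (of_nat d) (?h r) (?h g) = ?h h"
      using map_to_ac_wronskian[of "of_nat n" "of_nat d" r g] wronskian by simp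
    show "?h h ^ n = smult (to_ac c) (?h r ^ m)"
      using h by (metis map_to_ac_power map_to_ac_smult)
    show "?h r \<noteq> 0" "?h g \<noteq> 0" "?h h \<noteq> 0" using nz by (simp_all only: nz_ac not_False_eq_True)
  qed (use n dm h deg D in \<open>simp_all add: deg_ac\<close>)
  then obtain z where z: "?h r = smult (to_ac (lead_coeff r)) ([:- z, 1:] ^ degree r)"
    by (auto simp: deg_ac coeff_map_poly)
  have "z = 0"
  proof (rule ccontr)
    assume "z \<noteq> 0"
    have "coeff ([:-z, 1:] ^ k) 0 = (-z) ^ k" for k
      by (induction k) (simp_all add: coeff_mult_0)
    then have 0: "to_ac (coeff r 0) \<noteq> 0"
      using arg_cong[OF z, of "\<lambda>p. coeff p 0"] \<open>z \<noteq> 0\<close> nz by (simp add: coeff_map_poly)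
    have "coeff ([:-z, 1:] ^ Suc k) k = - (of_nat (Suc k) * z)" for k
    proof (induction k)
      case (Suc k)
      have "coeff ([:-z, 1:] ^ Suc k) (Suc k) = 1"
        by (metis degree_linear_power[of "-z" "Suc k"] lead_coeff_power lead_coeff_pCons(1) one_neq_zero power_one lead_coeff_1 one_pCons pCons_one)
      moreover have "coeff ([:-z, 1:] ^ Suc (Suc k)) (Suc k)
          = coeff ([:-z, 1:] ^ Suc k) k - z * coeff ([:-z, 1:] ^ Suc k) (Suc k)"
        by (subst power_Suc) (simp del: power_Suc)
      ultimately show ?case unfolding Suc.IH by (simp add: algebra_simps)
    qed simp
    from this[of "degree r - 1"] D
    have "coeff ([:-z, 1:] ^ degree r) (degree r - 1) = - (of_nat (degree r) * z)" by simp
    then have 1: "to_ac (coeff r (degree r - 1)) \<noteq> 0"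
      using arg_cong[OF z, of "\<lambda>p. coeff p (degree r - 1)"] \<open>z \<noteq> 0\<close> nz D by (simp add: coeff_map_poly)
    show False using 0 1 miss by auto
  qed
  then have "?h r = ?h (monom (lead_coeff r) (degree r))"
    using z by (subst map_poly_monom[of to_ac, OF to_ac_0], subst monom_altdef) (metis minus_zero)
  then show ?thesis
    by (intro poly_eqI) (metis coeff_map_poly to_ac_0 to_ac_eq_iff)
qed

section \<open>Coefficients with respect to the basis of monomials\<close>

lemma weyl_representation_total: "x \<in> weyl.span weyl_basis" for x :: "'f::field_char_0 weyl"
  by (simp add: weyl_basis_span)

lemma weyl_coeff_zero [simp]: "weyl_coeff 0 i j = 0"
  by (simp add: weyl_coeff_def weyl.representation_zero)

lemma weyl_coeff_add [simp]: "weyl_coeff (x + y) i j = weyl_coeff x i j + weyl_coeff y i j"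
  by (simp add: weyl_coeff_def weyl.representation_add weyl_basis_independent weyl_representation_total)

lemma weyl_coeff_diff [simp]: "weyl_coeff (x - y) i j = weyl_coeff x i j - weyl_coeff y i j"
  by (simp add: weyl_coeff_def weyl.representation_diff weyl_basis_independent weyl_representation_total)

lemma weyl_coeff_scale [simp]: "weyl_coeff (weyl_scale c x) i j = c * weyl_coeff x i j"
  by (simp add: weyl_coeff_def weyl.representation_scale weyl_basis_independent weyl_representation_total)

lemma weyl_coeff_mono: "weyl_coeff (weyl_mono k l) i j = (if i = k \<and> j = l then 1 else 0)"
proof -
  have "weyl.representation weyl_basis (weyl_mono k l) = (\<lambda>v. if v = weyl_mono k l then 1 else 0 :: 'a)"
    by (rule weyl.representation_basis[OF weyl_basis_independent]) (auto simp: weyl_basis_def)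
  then show ?thesis by (auto simp: weyl_coeff_def weyl_mono_inj)
qed

lemma weyl_eq_0_iff: "x = 0 \<longleftrightarrow> (\<forall>i j. weyl_coeff x i j = 0)"
proof
  assume "\<forall>i j. weyl_coeff x i j = 0"
  then have "weyl_supp x = {}" by (simp add: weyl_supp_def)
  then show "x = 0" using weyl_expansion[of x] by simp
qed simp

section \<open>The weight filtration\<close>

text \<open>Weights are integers, so that bounds such as \<open>d - w\<close> may become negative; the filtration is then
  zero. The symbol of weight \<open>d\<close> is the part of weight \<open>d\<close> with \<open>Y\<close> set to \<open>1\<close>, which loses no
  information since the exponent of \<open>X\<close> and the weight determine the exponent of \<open>Y\<close>.\<close>

locale direction =
  fixes \<rho> \<sigma> :: nat
  assumes \<rho>_pos: "\<rho> > 0" and \<sigma>_pos: "\<sigma> > 0"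
begin

definition wt :: "nat \<Rightarrow> nat \<Rightarrow> int" where "wt i j = int (i * \<rho> + j * \<sigma>)"

definition Fil :: "int \<Rightarrow> 'f::field_char_0 weyl set"
  where "Fil d = {x. \<forall>i j. weyl_coeff x i j \<noteq> 0 \<longrightarrow> wt i j \<le> d}"

definition symb :: "int \<Rightarrow> 'f::field_char_0 weyl \<Rightarrow> 'f poly"
  where "symb d x = (\<Sum>(i, j) | wt i j = d. monom (weyl_coeff x i j) i)"

lemma finite_wt: "finite {(i, j). wt i j = d}"
proof (rule finite_subset)
  have "i \<le> i * \<rho>" "j \<le> j * \<sigma>" for i j using \<rho>_pos \<sigma>_pos by (cases \<rho>; cases \<sigma>; simp)+
  then have "i \<le> i * \<rho> + j * \<sigma>" "j \<le> i * \<rho> + j * \<sigma>" for i j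
    by (meson trans_le_add1 trans_le_add2)+
  then show "{(i, j). wt i j = d} \<subseteq> {..nat d} \<times> {..nat d}"
    by (auto simp: wt_def simp del: of_nat_add of_nat_mult)
qed simp

lemma coeff_symb: "wt i j = d \<Longrightarrow> coeff (symb d x) i = weyl_coeff x i j"
proof -
  assume d: "wt i j = d"
  have "coeff (symb d x) i = (\<Sum>(a, b)\<in>{(a, b). wt a b = d}. if a = i then weyl_coeff x a b else 0)"
    unfolding symb_def coeff_sum by (intro sum.cong) auto
  also have "\<dots> = (\<Sum>(a, b)\<in>{(i, j)}. if a = i then weyl_coeff x a b else 0)"
    using d \<sigma>_pos by (intro sum.mono_neutral_right finite_wt) (auto simp: wt_def split: if_splits)
  finally show ?thesis by simp
qed

lemma coeff_symb_nonzero: "coeff (symb d x) i \<noteq> 0 \<Longrightarrow> \<exists>j. wt i j = d \<and> weyl_coeff x i j \<noteq> 0"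
proof (rule ccontr)
  assume "coeff (symb d x) i \<noteq> 0" "\<not> ?thesis"
  moreover from this(2) have "coeff (symb d x) i = 0"
    unfolding symb_def coeff_sum by (intro sum.neutral) auto
  ultimately show False by simp
qed

lemma symb_add: "symb d (x + y) = symb d x + symb d y"
  by (simp add: symb_def case_prod_unfold sum.distrib flip: add_monom)

lemma symb_diff: "symb d (x - y) = symb d x - symb d y"
  by (simp add: symb_def case_prod_unfold sum_subtractf flip: diff_monom)

lemma symb_scale: "symb d (weyl_scale c x) = smult c (symb d x)"
  by (rule poly_eqI) (simp add: symb_def case_prod_unfold coeff_sum sum_distrib_left if_distrib cong: if_cong)

lemma symb_zero [simp]: "symb d 0 = 0"
  by (simp add: symb_def case_prod_unfold)

lemma symb_mono: "symb d (weyl_mono i j) = (if wt i j = d then monom 1 i else 0)"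
proof (rule poly_eqI)
  fix k
  show "coeff (symb d (weyl_mono i j)) k = coeff (if wt i j = d then monom 1 i else 0 :: 'a poly) k"
  proof (cases "coeff (symb d (weyl_mono i j)) k = (0 :: 'a)")
    case True
    then show ?thesis using coeff_symb[of i j d "weyl_mono i j :: 'a weyl"]
      by (auto simp: weyl_coeff_mono)
  next
    case False
    then obtain l where "wt k l = d" "weyl_coeff (weyl_mono i j :: 'a weyl) k l \<noteq> 0"
      using coeff_symb_nonzero by blast
    then show ?thesis using coeff_symb[of k l d "weyl_mono i j :: 'a weyl"]
      by (auto simp: weyl_coeff_mono split: if_splits)
  qed
qed

lemma Fil_zero [simp]: "0 \<in> Fil d"
  by (simp add: Fil_def)

lemma Fil_add: "x \<in> Fil d \<Longrightarrow> y \<in> Fil d \<Longrightarrow> x + y \<in> Fil d"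
  by (auto simp: Fil_def) (metis add.right_neutral)

lemma Fil_diff: "x \<in> Fil d \<Longrightarrow> y \<in> Fil d \<Longrightarrow> x - y \<in> Fil d"
  by (auto simp: Fil_def) (metis diff_zero)

lemma Fil_scale: "x \<in> Fil d \<Longrightarrow> weyl_scale c x \<in> Fil d"
  by (auto simp: Fil_def)

lemma Fil_mono: "wt i j \<le> d \<Longrightarrow> weyl_mono i j \<in> Fil d"
  by (auto simp: Fil_def weyl_coeff_mono split: if_splits)

lemma Fil_le: "x \<in> Fil d \<Longrightarrow> d \<le> e \<Longrightarrow> x \<in> Fil e"
  by (force simp: Fil_def)

lemma symb_Fil_less: "x \<in> Fil d \<Longrightarrow> d < e \<Longrightarrow> symb e x = 0"
  by (rule poly_eqI, rule ccontr) (use coeff_symb_nonzero in \<open>force simp: Fil_def\<close>)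

lemma Fil_drop: "x \<in> Fil d \<Longrightarrow> symb d x = 0 \<Longrightarrow> x \<in> Fil (d - 1)"
  using coeff_symb unfolding Fil_def by (smt (verit) coeff_0 mem_Collect_eq)

lemma Fil_induct [consumes 1, case_names zero mono add]:
  assumes "x \<in> Fil d"
    and zero: "Q 0"
    and mono: "\<And>i j c. wt i j \<le> d \<Longrightarrow> Q (weyl_scale c (weyl_mono i j))"
    and add: "\<And>x y. Q x \<Longrightarrow> Q y \<Longrightarrow> Q (x + y)"
  shows "Q x"
proof -
  have "Q (\<Sum>(i, j)\<in>S. weyl_scale (weyl_coeff x i j) (weyl_mono i j))" if "finite S" "S \<subseteq> weyl_supp x" for S
    using that
  proof (induction S rule: finite_induct)
    case (insert z S)
    obtain i j where z: "z = (i, j)" by force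
    then have "wt i j \<le> d" using insert.prems assms(1) by (auto simp: Fil_def weyl_supp_def)
    then show ?case using insert z by (simp add: add mono)
  qed (simp add: zero)
  from this[OF finite_weyl_supp order_refl] show ?thesis by (simp add: weyl_expansion)
qed

lemma wt_simps: "wt (Suc i) j = wt i j + int \<rho>" "wt i (Suc j) = wt i j + int \<sigma>"
  "wt (i + k) (j + l) = wt i j + wt k l"
  by (simp_all add: wt_def algebra_simps)

lemma wt_nonneg: "wt i j \<ge> 0" by (simp add: wt_def)

lemma Fil_mult_p: "y \<in> Fil d \<Longrightarrow> weyl_p * y \<in> Fil (d + int \<rho>)"
proof (induction rule: Fil_induct)
  case (mono i j c)
  have "weyl_p * weyl_mono i j = (weyl_mono (Suc i) j :: 'a weyl)"
    by (simp add: weyl_mono_def mult.assoc)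
  then show ?case using mono by (simp add: weyl_scale_mult_right Fil_scale Fil_mono wt_simps)
qed (simp_all add: distrib_left Fil_add)

lemma q_mult_mono: "weyl_q * weyl_mono i j =
    weyl_mono i (Suc j) - weyl_scale (of_nat i) (weyl_mono (i - 1) j :: 'f::field_char_0 weyl)"
proof -
  have "weyl_q * weyl_mono i j = (weyl_q * weyl_p ^ i) * (weyl_q ^ j :: 'f weyl)"
    by (simp add: weyl_mono_def mult.assoc)
  then show ?thesis
    by (simp add: weyl_q_p_power left_diff_distrib weyl_of_nat_mult weyl_scale_mult_left)
      (simp add: weyl_mono_def mult.assoc)
qed

lemma Fil_mult_q: "y \<in> Fil d \<Longrightarrow> weyl_q * y \<in> Fil (d + int \<sigma>)"
proof (induction rule: Fil_induct)
  case (mono i j c)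
  have "wt (i - 1) j \<le> wt i j" by (simp add: wt_def mult_right_mono)
  then show ?case using mono
    by (simp add: weyl_scale_mult_right Fil_scale q_mult_mono Fil_diff Fil_mono wt_simps)
qed (simp_all add: distrib_left Fil_add)

lemma Fil_q_power_right: "y \<in> Fil d \<Longrightarrow> y * weyl_q ^ l \<in> Fil (d + int (l * \<sigma>))"
proof (induction rule: Fil_induct)
  case (mono i j c)
  have "weyl_mono i j * weyl_q ^ l = (weyl_mono i (j + l) :: 'a weyl)"
    by (simp add: weyl_mono_def mult.assoc power_add)
  then show ?case using mono
    by (simp add: weyl_scale_mult_left Fil_scale Fil_mono wt_def algebra_simps)
qed (simp_all add: distrib_right Fil_add)

lemma Fil_p_power_left: "y \<in> Fil d \<Longrightarrow> weyl_p ^ i * y \<in> Fil (d + int (i * \<rho>))"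
proof (induction i)
  case (Suc i)
  then show ?case using Fil_mult_p[of "weyl_p ^ i * y" "d + int (i * \<rho>)"]
    by (simp add: mult.assoc algebra_simps)
qed simp

text \<open>The weight of \<open>pq\<close>, which is the amount by which each application of \<open>pq - qp = 1\<close> lowers the weight.\<close>

abbreviation w :: int where "w \<equiv> int \<rho> + int \<sigma>"

text \<open>The first correction is made explicit because it becomes the main term of commutators, where the
  monomials themselves cancel; everything beyond it has weight lower by \<open>2w\<close>. In the degenerate cases
  \<open>j = 0\<close> or \<open>k = 0\<close> the factor \<open>jk\<close> removes the term whose exponents would be negative.\<close>

lemma q_power_p_power:
  "weyl_q ^ j * weyl_p ^ k - weyl_mono k j
    + weyl_scale (of_nat (j * k)) (weyl_mono (k - 1) (j - 1)) \<in> Fil (wt k j - 2 * w)"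
proof (induction j)
  case 0
  show ?case by (simp add: weyl_mono_def)
next
  case (Suc j)
  define E where "E = weyl_q ^ j * weyl_p ^ k - weyl_mono k j
    + weyl_scale (of_nat (j * k)) (weyl_mono (k - 1) (j - 1) :: 'a weyl)"
  have E: "weyl_q * E \<in> Fil (wt k (Suc j) - 2 * w)"
    using Fil_mult_q[OF Suc] by (simp add: E_def wt_simps algebra_simps)
  have qE: "weyl_q ^ Suc j * weyl_p ^ k = weyl_q * E + weyl_q * weyl_mono k j
      - weyl_scale (of_nat (j * k)) (weyl_q * weyl_mono (k - 1) (j - 1))"
    by (simp add: E_def algebra_simps weyl_scale_mult_right)
  have s: "weyl_scale (of_nat (j * k)) (weyl_mono (k - 1) (Suc (j - 1)))
      = weyl_scale (of_nat (j * k)) (weyl_mono (k - 1) j :: 'a weyl)"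
    by (cases j) simp_all
  have "weyl_q ^ Suc j * weyl_p ^ k - weyl_mono k (Suc j)
      + weyl_scale (of_nat (Suc j * k)) (weyl_mono (k - 1) j)
    = weyl_q * E + weyl_scale (of_nat (j * k * (k - 1))) (weyl_mono (k - 1 - 1) (j - 1))"
    unfolding qE q_mult_mono weyl.scale_right_diff_distrib s
    by (simp add: weyl.scale_left_distrib distrib_right)
  moreover have "weyl_scale (of_nat (j * k * (k - 1))) (weyl_mono (k - 1 - 1) (j - 1) :: 'a weyl)
      \<in> Fil (wt k (Suc j) - 2 * w)"
  proof (cases "j = 0 \<or> k \<le> 1")
    case True
    then have "j * k * (k - 1) = 0" by (cases k) auto
    then show ?thesis by (simp only: of_nat_0 weyl.scale_zero_left Fil_zero)
  next
    case False
    then obtain j' k' where "j = Suc j'" "k = Suc (Suc k')"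
      by (metis Suc_diff_Suc diff_zero gr0I not_le One_nat_def Suc_lessE)
    then show ?thesis by (intro Fil_scale Fil_mono) (simp add: wt_simps)
  qed
  ultimately show ?case using E by (simp add: Fil_add)
qed

lemma mono_mult:
  "weyl_mono i j * weyl_mono k l - weyl_mono (i + k) (j + l)
    + weyl_scale (of_nat (j * k)) (weyl_mono (i + k - 1) (j + l - 1)) \<in> Fil (wt i j + wt k l - 2 * w)"
proof -
  let ?E = "weyl_q ^ j * weyl_p ^ k - weyl_mono k j
    + weyl_scale (of_nat (j * k)) (weyl_mono (k - 1) (j - 1) :: 'a weyl)"
  have m: "weyl_p ^ i * weyl_mono a b * weyl_q ^ l = (weyl_mono (i + a) (b + l) :: 'a weyl)" for a b
    by (simp add: weyl_mono_def power_add mult.assoc)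
  have z: "weyl_scale (of_nat (j * k)) (weyl_mono (i + k - 1) (j + l - 1))
      = weyl_scale (of_nat (j * k)) (weyl_mono (i + (k - 1)) (j - 1 + l) :: 'a weyl)"
    by (cases "j = 0 \<or> k = 0") auto
  have "weyl_p ^ i * ?E * weyl_q ^ l = weyl_mono i j * weyl_mono k l - weyl_mono (i + k) (j + l)
    + weyl_scale (of_nat (j * k)) (weyl_mono (i + k - 1) (j + l - 1))"
    unfolding z m[symmetric]
    by (simp add: distrib_left distrib_right left_diff_distrib right_diff_distrib
        weyl_scale_mult_left weyl_scale_mult_right) (simp add: weyl_mono_def mult.assoc)
  moreover have "weyl_p ^ i * ?E * weyl_q ^ l \<in> Fil (wt k j - 2 * w + int (i * \<rho>) + int (l * \<sigma>))"
    by (intro Fil_q_power_right Fil_p_power_left q_power_p_power)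
  moreover have "wt k j - 2 * w + int (i * \<rho>) + int (l * \<sigma>) = wt i j + wt k l - 2 * w"
    by (simp add: wt_def)
  ultimately show ?thesis by (simp only:)
qed

lemma mono_mult_Fil: "weyl_mono i j * weyl_mono k l - weyl_mono (i + k) (j + l) \<in> Fil (wt i j + wt k l - w)"
proof -
  have a: "weyl_scale (of_nat (j * k)) (weyl_mono (i + k - 1) (j + l - 1) :: 'a weyl) \<in> Fil (wt i j + wt k l - w)"
  proof (cases "j = 0 \<or> k = 0")
    case False
    then obtain j' k' where "j = Suc j'" "k = Suc k'" by (metis not0_implies_Suc)
    then show ?thesis by (intro Fil_scale Fil_mono) (simp add: wt_def algebra_simps)
  qed auto
  have b: "weyl_mono i j * weyl_mono k l - weyl_mono (i + k) (j + l)
    + weyl_scale (of_nat (j * k)) (weyl_mono (i + k - 1) (j + l - 1) :: 'a weyl)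
    \<in> Fil (wt i j + wt k l - w)"
    by (rule Fil_le[OF mono_mult]) simp
  show ?thesis using Fil_diff[OF b a] by (simp only: add_diff_cancel)
qed

text \<open>The main term is the Poisson bracket of \<open>X\<^sup>iY\<^sup>j\<close> and \<open>X\<^sup>kY\<^sup>l\<close>.\<close>

lemma mono_commutator:
  "weyl_mono i j * weyl_mono k l - weyl_mono k l * weyl_mono i j
    - weyl_scale (of_nat (i * l) - of_nat (j * k)) (weyl_mono (i + k - 1) (j + l - 1))
    \<in> Fil (wt i j + wt k l - 2 * w)"
  using Fil_diff[OF mono_mult[of i j k l] mono_mult[of k l i j, unfolded add.commute[of "wt k l"]]]
  by (simp add: algebra_simps weyl.scale_left_diff_distrib)


section \<open>The graded ring and its Poisson bracket\<close>

lemma Fil_symb_mult: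
  assumes "x \<in> Fil d" "y \<in> Fil e"
  shows "x * y \<in> Fil (d + e) \<and> symb (d + e) (x * y) = symb d x * symb e y"
  using assms(1)
proof (induction rule: Fil_induct)
  case (mono i j c)
  note ij = mono
  show ?case using assms(2)
  proof (induction rule: Fil_induct)
    case (mono k l c')
    let ?M = "weyl_mono i j * weyl_mono k l :: 'a weyl"
    have le: "?M - weyl_mono (i + k) (j + l) \<in> Fil (wt i j + wt k l - w)" by (rule mono_mult_Fil)
    have W: "wt i j + wt k l - w < d + e" using ij mono \<rho>_pos \<sigma>_pos by simp
    have "?M - weyl_mono (i + k) (j + l) \<in> Fil (d + e)" using Fil_le[OF le] W by simp
    moreover have "weyl_mono (i + k) (j + l) \<in> Fil (d + e)" using ij mono by (intro Fil_mono) (simp add: wt_simps)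
    ultimately have M: "?M \<in> Fil (d + e)" using Fil_add by (metis diff_add_cancel)
    have "symb (d + e) ?M = symb (d + e) (weyl_mono (i + k) (j + l))"
      using symb_Fil_less[OF le W] by (simp add: symb_diff)
    also have "\<dots> = symb d (weyl_mono i j) * symb e (weyl_mono k l)"
      using ij mono by (auto simp: symb_mono wt_simps mult_monom)
    finally show ?case using M
      by (simp add: weyl_scale_mult_left weyl_scale_mult_right Fil_scale symb_scale)
  qed (simp_all add: distrib_left Fil_add symb_add)
qed (simp_all add: distrib_right Fil_add symb_add)

text \<open>The graded form of the commutator: by bilinearity it suffices to treat monomials; those of
  weights \<open>d\<close> and \<open>e\<close> satisfy \<open>\<sigma>(il - jk) = e i - d k\<close>.\<close>

lemma Fil_symb_commutator:
  assumes "x \<in> Fil d" "y \<in> Fil e"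
  shows "x * y - y * x \<in> Fil (d + e - w) \<and>
    smult (of_nat \<sigma>) (symb (d + e - w) (x * y - y * x)) = wronskian (of_int d) (of_int e) (symb d x) (symb e y)"
  using assms(1)
proof (induction rule: Fil_induct)
  case (mono i j c)
  note ij = mono
  show ?case using assms(2)
  proof (induction rule: Fil_induct)
    case (mono k l c')
    let ?C = "weyl_mono i j * weyl_mono k l - weyl_mono k l * weyl_mono i j :: 'a weyl"
    let ?a = "of_nat (i * l) - of_nat (j * k) :: 'a"
    let ?S = "weyl_scale ?a (weyl_mono (i + k - 1) (j + l - 1))"
    define W where "W = wt i j + wt k l"
    have w: "w > 0" using \<rho>_pos by simp
    have W: "W \<le> d + e" using ij mono by (simp add: W_def)
    have CS: "?C - ?S \<in> Fil (W - 2 * w)" unfolding W_def by (rule mono_commutator)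
    have wS: "wt (i + k - 1) (j + l - 1) = W - w" if "?a \<noteq> 0"
    proof -
      have "i * l \<noteq> 0 \<or> j * k \<noteq> 0" using that by auto
      then obtain a b where "i + k = Suc a" "j + l = Suc b"
        by (metis add_is_0 mult_is_0 not0_implies_Suc)
      then have "wt (i + k) (j + l) = wt (i + k - 1) (j + l - 1) + w" by (simp add: wt_simps(1,2))
      then show ?thesis by (simp add: W_def wt_simps)
    qed
    have S: "?S \<in> Fil (W - w)"
    proof (cases "?a = 0")
      case True
      show ?thesis unfolding True by simp
    next
      case False
      show ?thesis by (intro Fil_scale Fil_mono) (simp only: wS[OF False] order_refl)
    qed
    have "?C - ?S \<in> Fil (W - w)" by (rule Fil_le[OF CS]) (use w in simp)
    then have "?C - ?S + ?S \<in> Fil (W - w)" using S by (rule Fil_add)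
    then have C: "?C \<in> Fil (W - w)" by (simp only: diff_add_cancel)
    have "symb (d + e - w) (?C - ?S) = 0" by (rule symb_Fil_less[OF CS]) (use w W in simp)
    then have sC: "symb (d + e - w) ?C = symb (d + e - w) ?S" by (simp only: symb_diff right_minus_eq)
    have "smult (of_nat \<sigma>) (symb (d + e - w) ?S)
        = wronskian (of_int d) (of_int e) (symb d (weyl_mono i j)) (symb e (weyl_mono k l))"
    proof (cases "W = d + e")
      case False
      then have "symb (d + e - w) ?S = 0" by (intro symb_Fil_less[OF S]) (use W in simp)
      moreover have "wt i j \<noteq> d \<or> wt k l \<noteq> e" using False by (auto simp: W_def)
      ultimately show ?thesis by (auto simp: symb_mono)
    next
      case True
      then have de: "wt i j = d" "wt k l = e" using ij mono by (simp_all add: W_def)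
      have m1: "monom (of_nat i) (i - 1) * monom 1 k = monom (of_nat i :: 'a) (i + k - 1)"
        by (cases i) (simp_all add: mult_monom)
      have m2: "monom 1 i * monom (of_nat k) (k - 1) = monom (of_nat k :: 'a) (i + k - 1)"
        by (cases k) (simp_all add: mult_monom)
      have "symb (d + e - w) ?S = monom ?a (i + k - 1)"
        using wS True by (cases "?a = 0") (simp_all add: symb_scale symb_mono smult_monom)
      moreover have "of_nat \<sigma> * ?a = of_int e * of_nat i - of_int d * of_nat k"
        unfolding de[symmetric] wt_def by (simp add: algebra_simps)
      ultimately show ?thesis
        by (simp add: symb_mono de wronskian_def pderiv_monom m1[simplified] m2[simplified] smult_monom diff_monom)
    qed
    then have fC: "smult (of_nat \<sigma>) (symb (d + e - w) ?C)
        = wronskian (of_int d) (of_int e) (symb d (weyl_mono i j)) (symb e (weyl_mono k l))"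
      by (simp only: sC)
    have bil: "weyl_scale c (weyl_mono i j) * weyl_scale c' (weyl_mono k l)
        - weyl_scale c' (weyl_mono k l) * weyl_scale c (weyl_mono i j) = weyl_scale (c * c') ?C"
      by (simp add: weyl_scale_mult_left weyl_scale_mult_right weyl.scale_right_diff_distrib mult.commute)
    have C': "?C \<in> Fil (d + e - w)" by (rule Fil_le[OF C]) (use W in simp)
    show ?case unfolding bil
    proof
      show "weyl_scale (c * c') ?C \<in> Fil (d + e - w)" using C' by (rule Fil_scale)
      have "smult (of_nat \<sigma>) (symb (d + e - w) (weyl_scale (c * c') ?C))
          = smult (c * c') (smult (of_nat \<sigma>) (symb (d + e - w) ?C))"
        by (simp only: symb_scale smult_smult mult.commute)
      then show "smult (of_nat \<sigma>) (symb (d + e - w) (weyl_scale (c * c') ?C)) = wronskian (of_int d) (of_int e)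
          (symb d (weyl_scale c (weyl_mono i j))) (symb e (weyl_scale c' (weyl_mono k l)))"
        by (simp only: fC symb_scale wronskian_smult smult_smult mult.commute[of c'])
    qed
  next
    case (add y z)
    have "weyl_scale c (weyl_mono i j) * (y + z) - (y + z) * weyl_scale c (weyl_mono i j)
      = (weyl_scale c (weyl_mono i j) * y - y * weyl_scale c (weyl_mono i j))
      + (weyl_scale c (weyl_mono i j) * z - z * weyl_scale c (weyl_mono i j))" by (simp add: algebra_simps)
    then show ?case using add by (simp only: Fil_add symb_add wronskian_add smult_add_right simp_thms)
  qed simp
next
  case (add x z)
  have "(x + z) * y - y * (x + z) = (x * y - y * x) + (z * y - y * z)" by (simp add: algebra_simps)
  then show ?case using add by (simp only: Fil_add symb_add wronskian_add smult_add_right simp_thms)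
qed simp

definition has_weight :: "nat \<Rightarrow> 'f::field_char_0 weyl \<Rightarrow> bool"
  where "has_weight d x \<longleftrightarrow> x \<in> Fil (int d) \<and> symb (int d) x \<noteq> 0"

lemma has_weight_exists:
  assumes "x \<noteq> 0"
  shows "\<exists>d. has_weight d x"
proof -
  define d where "d = Max ((\<lambda>(i, j). wt i j) ` weyl_supp x)"
  have fin: "finite ((\<lambda>(i, j). wt i j) ` weyl_supp x)" using finite_weyl_supp by blast
  have ne: "weyl_supp x \<noteq> {}" using assms by (auto simp: weyl_supp_def weyl_eq_0_iff)
  have "x \<in> Fil d" using Max_ge[OF fin] by (force simp: Fil_def d_def weyl_supp_def)
  moreover have "d \<in> (\<lambda>(i, j). wt i j) ` weyl_supp x" unfolding d_def by (rule Max_in) (use fin ne in auto)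
  then obtain i j where "wt i j = d" "weyl_coeff x i j \<noteq> 0" by (auto simp: weyl_supp_def)
  then have "symb d x \<noteq> 0" using coeff_symb by (metis coeff_0)
  moreover have "d \<ge> 0" using \<open>wt i j = d\<close> wt_nonneg by blast
  ultimately show ?thesis unfolding has_weight_def by (metis nat_0_le)
qed

lemma has_weight_le_Fil: "has_weight d x \<Longrightarrow> x \<in> Fil e \<Longrightarrow> int d \<le> e"
  unfolding has_weight_def using symb_Fil_less by (meson not_le)

lemma Fil_one: "1 \<in> Fil 0" and symb_one: "symb 0 1 = 1"
  using Fil_mono[of 0 0 0] symb_mono[of 0 0 0] by (simp_all add: weyl_mono_def wt_def)

lemma Fil_symb_power: "x \<in> Fil d \<Longrightarrow> x ^ k \<in> Fil (int k * d) \<and> symb (int k * d) (x ^ k) = symb d x ^ k"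
proof (induction k)
  case (Suc k)
  then show ?case using Fil_symb_mult[of x d "x ^ k" "int k * d"] by (simp add: algebra_simps)
qed (simp add: Fil_one symb_one)

lemma Fil_0_central:
  assumes "x \<in> Fil 0" shows "x * y = y * x"
  using assms
proof (induction rule: Fil_induct)
  case (mono i j c)
  then have "i * \<rho> + j * \<sigma> = 0" unfolding wt_def by linarith
  then have "i = 0" "j = 0" using \<rho>_pos \<sigma>_pos by simp_all
  then show ?case by (simp add: weyl_mono_def weyl_scale_mult_left weyl_scale_mult_right)
qed (simp_all add: distrib_left distrib_right)

lemma Fil_symb_commutator_power:
  assumes "g \<in> Fil d" "x * g - g * x \<in> Fil e"
  shows "x * g ^ Suc k - g ^ Suc k * x \<in> Fil (e + int k * d) \<and>
    symb (e + int k * d) (x * g ^ Suc k - g ^ Suc k * x)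
      = smult (of_nat (Suc k)) (symb d g ^ k * symb e (x * g - g * x))"
proof (induction k)
  case 0
  show ?case using assms by simp
next
  case (Suc k)
  have s: "x * g ^ Suc (Suc k) - g ^ Suc (Suc k) * x
    = (x * g - g * x) * g ^ Suc k + g * (x * g ^ Suc k - g ^ Suc k * x)"
    by (simp add: algebra_simps)
  have 1: "(x * g - g * x) * g ^ Suc k \<in> Fil (e + int (Suc k) * d) \<and>
     symb (e + int (Suc k) * d) ((x * g - g * x) * g ^ Suc k) = symb e (x * g - g * x) * symb d g ^ Suc k"
    using Fil_symb_mult[OF assms(2)] Fil_symb_power[OF assms(1)] by metis
  have e: "d + (e + int k * d) = e + int (Suc k) * d" by (simp add: algebra_simps)
  have 2: "g * (x * g ^ Suc k - g ^ Suc k * x) \<in> Fil (e + int (Suc k) * d) \<and>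
     symb (e + int (Suc k) * d) (g * (x * g ^ Suc k - g ^ Suc k * x))
      = symb d g * smult (of_nat (Suc k)) (symb d g ^ k * symb e (x * g - g * x))"
    using Fil_symb_mult[OF assms(1) conjunct1[OF Suc]] conjunct2[OF Suc] unfolding e by metis
  have "symb e (x * g - g * x) * symb d g ^ Suc k
      + symb d g * smult (of_nat (Suc k)) (symb d g ^ k * symb e (x * g - g * x))
    = smult (of_nat (Suc (Suc k))) (symb d g ^ Suc k * symb e (x * g - g * x))"
    by (subst of_nat_Suc[of "Suc k"]) (simp add: smult_add_left algebra_simps del: of_nat_Suc)
  then show ?case unfolding s symb_add using 1 2 by (simp only: Fil_add simp_thms)
qed

section \<open>The leading form equation of a solvable element\<close>

text \<open>The defect of \<open>G\<close>, here \<open>d + n - m\<close>, is at least \<open>\<rho> + \<sigma>\<close>, so there is an admissible \<open>G\<close> with the least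
  defect. There the Poisson bracket of the leading forms of \<open>x\<close> and \<open>G\<close> cannot vanish, since otherwise
  \<open>G\<^sup>n - c x\<^sup>d\<close> has a smaller defect: its commutator with \<open>x\<close> is that of \<open>G\<^sup>n\<close>, while its weight has
  dropped.\<close>

lemma leading_form_equation:
  fixes x y :: "'f::field_char_0 weyl"
  assumes xy: "x * y - y * x = 1" and x: "has_weight n x"
  defines "r \<equiv> symb (int n) x"
  shows "\<exists>G d m c. has_weight d G \<and> has_weight m (x * G - G * x) \<and> m + \<rho> + \<sigma> = n + d \<and> c \<noteq> 0
    \<and> wronskian (of_nat n) (of_nat d) r (symb (int d) G) = smult (of_nat \<sigma>) (symb (int m) (x * G - G * x))
    \<and> symb (int m) (x * G - G * x) ^ n = smult c (r ^ m)"
proof -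
  define P where "P = (\<lambda>(G, d, m). has_weight d G \<and> has_weight m (x * G - G * x) \<and>
     wronskian (of_nat n) (of_nat m) r (symb (int m) (x * G - G * x)) = 0)"
  define defi where "defi = (\<lambda>(G :: 'f weyl, d, m). d + n - m)"
  have r0: "r \<noteq> 0" and xF: "x \<in> Fil n" using x by (auto simp: has_weight_def r_def)
  have comm: "x * G - G * x \<in> Fil (int n + int d - w) \<and>
      smult (of_nat \<sigma>) (symb (int n + int d - w) (x * G - G * x)) = wronskian (of_nat n) (of_nat d) r (symb d G)"
    if "has_weight d G" for d G
    using Fil_symb_commutator[OF xF, of G "int d"] that by (simp add: has_weight_def r_def)
  have bound: "m + \<rho> + \<sigma> \<le> n + d" if "has_weight d G" "has_weight m (x * G - G * x)" for G d m
    using has_weight_le_Fil[OF that(2) conjunct1[OF comm[OF that(1)]]] by linarith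
  have "y \<noteq> 0" using xy by auto
  then obtain e where "has_weight e y" using has_weight_exists by blast
  moreover have "has_weight 0 (x * y - y * x)" unfolding xy by (simp add: has_weight_def Fil_one symb_one)
  ultimately have "P (y, e, 0)" by (simp add: P_def xy symb_one wronskian_def pderiv_1)
  from ex_has_least_nat[of P, OF this, of defi] obtain G d m where
    P: "P (G, d, m)" and least: "\<And>G' d' m'. P (G', d', m') \<Longrightarrow> defi (G, d, m) \<le> defi (G', d', m')"
    by (metis prod_cases3)
  define g h where "g = symb (int d) G" and "h = symb (int m) (x * G - G * x)"
  have G: "has_weight d G" and C: "has_weight m (x * G - G * x)" and hr: "wronskian (of_nat n) (of_nat m) r h = 0"
    using P by (auto simp: P_def h_def)
  have g0: "g \<noteq> 0" and h0: "h \<noteq> 0" and GF: "G \<in> Fil d" and CF: "x * G - G * x \<in> Fil m"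
    using G C by (auto simp: has_weight_def g_def h_def)
  have n: "n > 0"
  proof (rule ccontr)
    assume "\<not> n > 0"
    then have "x \<in> Fil 0" using xF by simp
    then show False using Fil_0_central[of x y] xy by simp
  qed
  have nonzero: "wronskian (of_nat n) (of_nat d) r g \<noteq> 0"
  proof
    assume z: "wronskian (of_nat n) (of_nat d) r g = 0"
    obtain c where c: "g ^ n = smult c (r ^ d)"
      using proportional_powers[OF r0 g0 z] by blast
    obtain k where k: "n = Suc k" using n by (metis gr0_implies_Suc)
    define T where "T = G ^ n - weyl_scale c (x ^ d)"
    have "T \<in> Fil (int n * int d) \<and> symb (int n * int d) T = 0"
    proof -
      have "G ^ n \<in> Fil (int n * int d) \<and> symb (int n * int d) (G ^ n) = g ^ n"
        using Fil_symb_power[OF GF, of n] by (simp add: g_def)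
      moreover have "x ^ d \<in> Fil (int n * int d) \<and> symb (int n * int d) (x ^ d) = r ^ d"
        using Fil_symb_power[OF xF, of d] by (simp add: r_def mult.commute)
      ultimately show ?thesis by (simp add: T_def Fil_diff Fil_scale symb_diff symb_scale c)
    qed
    then have T: "T \<in> Fil (int n * int d - 1)" using Fil_drop by blast
    have "x * T - T * x = x * G ^ n - G ^ n * x"
      by (simp add: T_def algebra_simps weyl_scale_mult_left weyl_scale_mult_right power_commutes)
    then have CT: "x * T - T * x \<in> Fil (int (m + k * d)) \<and>
        symb (int (m + k * d)) (x * T - T * x) = smult (of_nat n) (g ^ k * h)"
      using Fil_symb_commutator_power[OF GF CF, of k] by (simp add: k g_def h_def)
    then have lC: "has_weight (m + k * d) (x * T - T * x)"
      using g0 h0 n by (simp add: has_weight_def)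
    then have "T \<noteq> 0" by (auto simp: has_weight_def)
    then obtain d' where d': "has_weight d' T" using has_weight_exists by blast
    have "wronskian (of_nat n) (of_nat k * of_nat d) r (g ^ k) * g = 0"
      unfolding wronskian_power_right z by simp
    then have gk: "wronskian (of_nat n) (of_nat k * of_nat d) r (g ^ k) = 0" using g0 by simp
    have "wronskian (of_nat n) (of_nat k * of_nat d + of_nat m) r (g ^ k * h) = 0"
      unfolding wronskian_mult_right gk hr by simp
    then have "P (T, d', m + k * d)"
      using lC d' CT by (simp add: P_def wronskian_smult add.commute)
    from least[OF this] have "d + n - m \<le> d' + n - (m + k * d)" by (simp add: defi_def)
    moreover have "int d' \<le> int n * int d - 1" by (rule has_weight_le_Fil[OF d' T])
    then have "d' < d + k * d" unfolding k by (metis mult_Suc of_nat_mult zle_diff1_eq of_nat_less_iff)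
    moreover have "m + \<rho> + \<sigma> \<le> n + d" by (rule bound[OF G C])
    moreover have "m + k * d + \<rho> + \<sigma> \<le> n + d'" by (rule bound[OF d' lC])
    ultimately show False using \<rho>_pos by linarith
  qed
  have "symb (int n + int d - w) (x * G - G * x) \<noteq> 0"
    using comm[OF G] nonzero by (auto simp: g_def)
  then have "int n + int d - w \<le> int m"
    using symb_Fil_less[OF CF] by (meson not_le)
  then have m: "m + \<rho> + \<sigma> = n + d" using bound[OF G C] by linarith
  then have "int m = int n + int d - w" by linarith
  then have "wronskian (of_nat n) (of_nat d) r g = smult (of_nat \<sigma>) h"
    using comm[OF G] by (simp add: g_def h_def)
  moreover obtain c where "c \<noteq> 0" "h ^ n = smult c (r ^ m)"
    using proportional_powers[OF r0 h0 hr] by blast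
  ultimately show ?thesis using G C m unfolding g_def h_def by blast
qed

section \<open>Edges meet the coordinate axes\<close>

lemma symb_degree_wt: "symb d x \<noteq> 0 \<Longrightarrow> \<exists>j. wt (degree (symb d x)) j = d"
  using coeff_symb_nonzero[of d x "degree (symb d x)"] leading_coeff_0_iff by blast

text \<open>Let \<open>D\<close> be the degree of \<open>r\<close> and let \<open>(D, E)\<close> be the lower right end of the edge. If \<open>r\<close> has a
  single root and \<open>\<rho> > \<sigma>\<close>, that root is not \<open>0\<close>, so the constant coefficient does not vanish, which is
  a point on the \<open>Y\<close>-axis. If \<open>\<rho> < \<sigma>\<close>, the exponents of \<open>X\<close> on the edge are congruent modulo
  \<open>\<sigma> / gcd \<rho> \<sigma>\<close>, a number greater than \<open>1\<close>; hence there is no term \<open>X\<^bsup>D - 1\<^esup>\<close> and \<open>r\<close> cannot be such a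
  power, so that \<open>E = 0\<close>.\<close>

lemma edge_meets_axis:
  fixes x y :: "'f::field_char_0 weyl"
  assumes xy: "x * y - y * x = 1" and x: "has_weight n x"
    and two: "wt a b = n" "weyl_coeff x a b \<noteq> 0" "wt a' b' = n" "weyl_coeff x a' b' \<noteq> 0" "(a, b) \<noteq> (a', b')"
    and neq: "\<rho> \<noteq> \<sigma>"
  shows "(\<rho> > \<sigma> \<longrightarrow> (\<exists>j. wt 0 j = n \<and> weyl_coeff x 0 j \<noteq> 0)) \<and>
    (\<rho> < \<sigma> \<longrightarrow> (\<exists>i. wt i 0 = n \<and> weyl_coeff x i 0 \<noteq> 0))"
proof -
  define r where "r = symb (int n) x"
  obtain G d m c where G: "has_weight d G" and C: "has_weight m (x * G - G * x)" and m: "m + \<rho> + \<sigma> = n + d" and c: "c \<noteq> 0"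
    and wronskian: "wronskian (of_nat n) (of_nat d) r (symb (int d) G) = smult (of_nat \<sigma>) (symb (int m) (x * G - G * x))"
    and h: "symb (int m) (x * G - G * x) ^ n = smult c (r ^ m)"
    using leading_form_equation[OF xy x] unfolding r_def by blast
  define g h where "g = symb (int d) G" and "h = symb (int m) (x * G - G * x)"
  have nz: "r \<noteq> 0" "g \<noteq> 0" "h \<noteq> 0" using x G C by (simp_all add: has_weight_def r_def g_def h_def)
  have aa: "a \<noteq> a'"
  proof
    assume "a = a'"
    then have "wt a b = wt a b'" using two(1,3) by simp
    then have "b = b'" using \<sigma>_pos by (simp add: wt_def)
    then show False using two(5) \<open>a = a'\<close> by simp
  qed
  have ca: "coeff r a \<noteq> 0" "coeff r a' \<noteq> 0" using two by (simp_all add: r_def coeff_symb)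
  then have "a \<le> degree r" "a' \<le> degree r" by (simp_all add: le_degree)
  then have D: "degree r > 0" using aa by linarith
  have nm: "r \<noteq> monom (lead_coeff r) (degree r)"
  proof
    assume e: "r = monom (lead_coeff r) (degree r)"
    have "coeff r i = 0" if "i \<noteq> degree r" for i using that by (subst e) simp
    then show False using ca aa by metis
  qed
  obtain E where E: "wt (degree r) E = n" using symb_degree_wt nz(1) unfolding r_def by metis
  obtain A where A: "wt (degree g) A = d" using symb_degree_wt nz(2) unfolding g_def by metis
  obtain B where B: "wt (degree h) B = m" using symb_degree_wt nz(3) unfolding h_def by metis
  have "degree r * \<rho> > 0" using D \<rho>_pos by simp
  then have n: "n > 0" using E unfolding wt_def by linarith
  \<comment> \<open>The degree bound required by the lemma on single roots, the first case being no cancellation at infinity.\<close>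
  have deg: "degree g + degree r \<le> degree h + 1" if EE: "\<rho> > \<sigma> \<or> E > 0"
  proof (cases "d * degree r = n * degree g")
    case False
    then have "of_nat d * of_nat (degree r) \<noteq> (of_nat n * of_nat (degree g) :: 'f)"
      by (metis of_nat_eq_iff of_nat_mult)
    then have "degree r + degree g \<le> degree (wronskian (of_nat n) (of_nat d) r g) + 1"
      by (rule degree_wronskian[OF nz(1,2)])
    then show ?thesis using wronskian \<sigma>_pos by (simp add: g_def h_def add.commute)
  next
    case True
    define D \<kappa> \<eta> where "D = int (degree r)" and "\<kappa> = int (degree g)" and "\<eta> = int (degree h)"
    have hd: "n * degree h = m * degree r"
      using arg_cong[OF h, of degree] nz c by (simp add: h_def degree_power_eq)
    define \<delta> where "\<delta> = \<kappa> + D - \<eta>"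
    have i1: "int n * \<kappa> = int d * D" using True by (simp add: D_def \<kappa>_def flip: of_nat_mult)
    have i2: "int n * \<eta> = int m * D" using hd by (simp add: D_def \<eta>_def flip: of_nat_mult)
    have im: "int m + \<rho> + \<sigma> = int n + d" using m by linarith
    have "int n * \<delta> = int n * \<kappa> + int n * D - int n * \<eta>" by (simp add: \<delta>_def algebra_simps)
    also have "\<dots> = D * (int n + d - m)" unfolding i1 i2 by (simp add: algebra_simps)
    also have "int n + d - m = int \<rho> + int \<sigma>" using im by linarith
    finally have nd: "int n * \<delta> = D * (int \<rho> + int \<sigma>)" .
    have e1: "int n = D * \<rho> + int E * \<sigma>" using E by (simp add: wt_def D_def)
    have e2: "int d = \<kappa> * \<rho> + int A * \<sigma>" using A by (simp add: wt_def \<kappa>_def)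
    have e3: "int m = \<eta> * \<rho> + int B * \<sigma>" using B by (simp add: wt_def \<eta>_def)
    have Dp: "D > 0" using D by (simp add: D_def)
    \<comment> \<open>Cancellation gives \<open>n \<delta> = D (\<rho> + \<sigma>)\<close>, where \<open>D \<rho> \<le> n\<close>.\<close>
    have "\<delta> \<le> 1"
    proof (cases "\<rho> > \<sigma>")
      case True
      have "int n * \<delta> < int n * 2"
      proof -
        have "D * (int \<rho> + int \<sigma>) < D * (2 * int \<rho>)" using Dp True by simp
        also have "\<dots> \<le> 2 * int n" using e1 by simp
        finally show ?thesis using nd by simp
      qed
      then show ?thesis using n by simp
    next
      case False
      then have "E > 0" using EE by simp
      then have "D * \<rho> < int n" using e1 \<sigma>_pos by simp
      then have "D * \<rho> * (int \<rho> + int \<sigma>) < int n * (int \<rho> + int \<sigma>)" using \<sigma>_pos by simp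
      moreover have "int n * (\<rho> * \<delta>) = D * \<rho> * (int \<rho> + int \<sigma>)"
        using nd by (metis mult.assoc mult.commute)
      ultimately have "int n * (\<rho> * \<delta>) < int n * (int \<rho> + int \<sigma>)" by (simp only:)
      then have "\<rho> * \<delta> < int \<rho> + int \<sigma>" using n by simp
      \<comment> \<open>The relation between the weights, read off from the exponents of \<open>Y\<close> at the right ends: \<open>\<rho>(\<delta> - 1)\<close> is a
        multiple of \<open>\<sigma>\<close> that is smaller than \<open>\<sigma>\<close>.\<close>
      moreover have st: "\<sigma> * (int B + 1 - E - A) = \<rho> * \<delta> - \<rho>"
        using im unfolding e1 e2 e3 \<delta>_def by (simp add: algebra_simps)
      ultimately have "\<sigma> * (int B + 1 - E - A) < int \<sigma> * 1" by simp
      then have "int B + 1 - E - A < 1" using \<sigma>_pos by (simp only: mult_less_cancel_left_pos of_nat_0_less_iff)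
      then have "\<sigma> * (int B + 1 - E - A) \<le> 0" by (intro mult_nonneg_nonpos) simp_all
      then have "int \<rho> * \<delta> \<le> int \<rho> * 1" using st by simp
      then show ?thesis using \<rho>_pos by (simp only: mult_le_cancel_left_pos of_nat_0_less_iff)
    qed
    then show ?thesis by (simp add: \<delta>_def D_def \<kappa>_def \<eta>_def)
  qed
  have miss: False if "\<rho> > \<sigma> \<or> E > 0" "coeff r 0 = 0 \<or> coeff r (degree r - 1) = 0"
  proof -
    have "r = monom (lead_coeff r) (degree r)"
    proof (rule monom_if_missing_coeff[where g = g and h = "smult (of_nat \<sigma>) h" and c = "of_nat \<sigma> ^ n * c"])
      show "smult (of_nat \<sigma>) h \<noteq> 0" using nz \<sigma>_pos by simp
      show "wronskian (of_nat n) (of_nat d) r g = smult (of_nat \<sigma>) h" using wronskian by (simp add: g_def h_def)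
      show "smult (of_nat \<sigma>) h ^ n = smult (of_nat \<sigma> ^ n * c) (r ^ m)"
        using h unfolding smult_power h_def by simp
      show "of_nat \<sigma> ^ n * c \<noteq> 0" using c \<sigma>_pos by simp
      show "degree g + degree r \<le> degree (smult (of_nat \<sigma>) h) + 1" using deg that \<sigma>_pos by simp
      show "int m < int n + int d" using m \<rho>_pos by linarith
    qed (use nz n D that in auto)
    then show False using nm by blast
  qed
  show ?thesis
  proof (intro conjI impI)
    assume "\<rho> > \<sigma>"
    then have "coeff r 0 \<noteq> 0" using miss by blast
    then show "\<exists>j. wt 0 j = n \<and> weyl_coeff x 0 j \<noteq> 0" unfolding r_def by (rule coeff_symb_nonzero)
  next
    assume lt: "\<rho> < \<sigma>"
    have "coeff r (degree r - 1) = 0"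
    proof (rule ccontr)
      assume "coeff r (degree r - 1) \<noteq> 0"
      then obtain j where "wt (degree r - 1) j = n" unfolding r_def by (metis coeff_symb_nonzero)
      moreover obtain k where k: "degree r = Suc k" using D by (metis gr0_implies_Suc)
      ultimately have "int j * \<sigma> = \<rho> + int E * \<sigma>" using E by (simp add: wt_def algebra_simps)
      then have "(int j - int E) * \<sigma> = \<rho>" by (simp add: algebra_simps)
      then have "int \<sigma> dvd int \<rho>" by (metis dvd_triv_right)
      then show False using lt \<rho>_pos by (simp add: nat_dvd_not_less)
    qed
    then have "E = 0" using miss by blast
    then have "wt (degree r) 0 = n" using E by simp
    moreover from this have "weyl_coeff x (degree r) 0 \<noteq> 0"
      using nz(1) coeff_symb[of "degree r" 0 "int n" x] unfolding r_def by (metis leading_coeff_0_iff)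
    ultimately show "\<exists>i. wt i 0 = n \<and> weyl_coeff x i 0 \<noteq> 0" by blast
  qed
qed

section \<open>Faces and the position of edges\<close>

lemma weyl_face_eq:
  assumes "has_weight n x"
  shows "weyl_face \<rho> \<sigma> x = {(i, j). weyl_coeff x i j \<noteq> 0 \<and> wt i j = n}"
proof -
  have le: "i * \<rho> + j * \<sigma> \<le> n" if "weyl_coeff x i j \<noteq> 0" for i j
    using assms that unfolding has_weight_def Fil_def wt_def by (simp flip: of_nat_add of_nat_mult)
  obtain i j where ij: "weyl_coeff x i j \<noteq> 0" "i * \<rho> + j * \<sigma> = n"
  proof -
    have "lead_coeff (symb n x) \<noteq> 0" using assms by (simp add: has_weight_def)
    from coeff_symb_nonzero[OF this] show ?thesis using that by (auto simp: wt_def simp flip: of_nat_add of_nat_mult)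
  qed
  have "weyl_val \<rho> \<sigma> x = ereal (real n)" unfolding weyl_val_def
  proof (rule antisym)
    show "(SUP (i, j)\<in>weyl_supp x. ereal (real (i * \<rho> + j * \<sigma>))) \<le> ereal (real n)"
    proof (rule SUP_least)
      fix z assume "z \<in> weyl_supp x"
      then show "(case z of (i, j) \<Rightarrow> ereal (real (i * \<rho> + j * \<sigma>))) \<le> ereal (real n)"
        using le by (cases z) (simp add: weyl_supp_def del: of_nat_add of_nat_mult)
    qed
    have "(i, j) \<in> weyl_supp x" using ij by (simp add: weyl_supp_def)
    from SUP_upper[OF this, of "\<lambda>(i, j). ereal (real (i * \<rho> + j * \<sigma>))"]
    show "ereal (real n) \<le> (SUP (i, j)\<in>weyl_supp x. ereal (real (i * \<rho> + j * \<sigma>)))"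
      using ij(2) by (simp del: of_nat_add of_nat_mult)
  qed
  then show ?thesis
    by (auto simp: weyl_face_def weyl_supp_def wt_def simp del: of_nat_add of_nat_mult)
qed

end

lemma face_meets_axis:
  fixes x :: "'f::field_char_0 weyl"
  assumes "weyl_solvable x" "(\<rho>, \<sigma>) \<in> dirs" and two: "card (weyl_face \<rho> \<sigma> x) > 1"
  shows "(\<rho> > \<sigma> \<longrightarrow> (\<exists>j. (0, j) \<in> weyl_face \<rho> \<sigma> x)) \<and> (\<rho> < \<sigma> \<longrightarrow> (\<exists>i. (i, 0) \<in> weyl_face \<rho> \<sigma> x))"
proof (cases "\<rho> = \<sigma>")
  case False
  interpret direction \<rho> \<sigma> using assms(2) by unfold_locales (auto simp: dirs_def)
  obtain y where y: "x * y - y * x = 1" using assms(1) by (auto simp: weyl_solvable_def)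
  then have "x \<noteq> 0" by auto
  then obtain n where n: "has_weight n x" using has_weight_exists by blast
  have "\<exists>z z'. z \<in> weyl_face \<rho> \<sigma> x \<and> z' \<in> weyl_face \<rho> \<sigma> x \<and> z \<noteq> z'"
  proof (rule ccontr)
    assume "\<not> ?thesis"
    then have "\<forall>z\<in>weyl_face \<rho> \<sigma> x. \<forall>z'\<in>weyl_face \<rho> \<sigma> x. z = z'" by blast
    moreover have "finite (weyl_face \<rho> \<sigma> x)"
      by (rule finite_subset[OF _ finite_weyl_supp[of x]]) (auto simp: weyl_face_def)
    ultimately have "card (weyl_face \<rho> \<sigma> x) \<le> Suc 0" using card_le_Suc0_iff_eq by blast
    then show False using two by simp
  qed
  then obtain a b a' b' where "(a, b) \<in> weyl_face \<rho> \<sigma> x" "(a', b') \<in> weyl_face \<rho> \<sigma> x" "(a, b) \<noteq> (a', b')"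
    by auto
  then show ?thesis using edge_meets_axis[OF y n, of a b a' b'] False
    unfolding weyl_face_eq[OF n] by blast
qed simp

lemma face_weight_le:
  assumes "a \<in> weyl_face \<rho> \<sigma> x" "b \<in> weyl_supp x"
  shows "fst b * \<rho> + snd b * \<sigma> \<le> fst a * \<rho> + snd a * \<sigma>"
proof -
  have "ereal (real (fst b * \<rho> + snd b * \<sigma>)) \<le> weyl_val \<rho> \<sigma> x"
    unfolding weyl_val_def using SUP_upper[OF assms(2), of "\<lambda>(i, j). ereal (real (i * \<rho> + j * \<sigma>))"]
    by (simp add: case_prod_unfold)
  also have "\<dots> = ereal (real (fst a * \<rho> + snd a * \<sigma>))"
    using assms(1) by (auto simp: weyl_face_def)
  finally show ?thesis by (simp del: of_nat_add of_nat_mult)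
qed

text \<open>Each of the two points maximises its own linear functional. Eliminating one coordinate of the
  difference from the two resulting inequalities leaves the determinant \<open>\<rho>'\<sigma> - \<rho>\<sigma>'\<close>, which is positive.\<close>

lemma faces_ordered:
  assumes a: "a \<in> weyl_face \<rho> \<sigma> x" and b: "b \<in> weyl_face \<rho>' \<sigma>' x"
    and pos: "\<sigma> > 0" "\<sigma>' > 0" and lt: "real \<rho> / real \<sigma> < real \<rho>' / real \<sigma>'"
  shows "fst a \<le> fst b \<and> snd b \<le> snd a"
proof -
  define u v where "u = int (fst b) - int (fst a)" and "v = int (snd b) - int (snd a)"
  have 1: "u * \<rho> + v * \<sigma> \<le> 0"
    using face_weight_le[OF a, of b] b unfolding weyl_face_def u_def v_def
    by (auto simp: algebra_simps simp flip: of_nat_mult of_nat_add)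
  have 2: "u * \<rho>' + v * \<sigma>' \<ge> 0"
    using face_weight_le[OF b, of a] a unfolding weyl_face_def u_def v_def
    by (auto simp: algebra_simps simp flip: of_nat_mult of_nat_add)
  have "real (\<rho> * \<sigma>') < real (\<rho>' * \<sigma>)" using lt pos by (simp add: divide_simps mult.commute)
  then have det: "0 < int \<rho>' * \<sigma> - int \<rho> * \<sigma>'" by (simp only: of_nat_less_iff) (simp flip: of_nat_mult)
  have "0 \<le> (u * \<rho>' + v * \<sigma>') * \<sigma> - (u * \<rho> + v * \<sigma>) * \<sigma>'"
    using mult_nonneg_nonneg[OF 2, of "int \<sigma>"] mult_nonpos_nonneg[OF 1, of "int \<sigma>'"] by simp
  also have "\<dots> = u * (int \<rho>' * \<sigma> - int \<rho> * \<sigma>')" by (simp add: algebra_simps)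
  finally have u: "u \<ge> 0" using det by (simp add: zero_le_mult_iff)
  then have "v * \<sigma> \<le> 0" using 1 by (smt (verit) mult_nonneg_nonneg of_nat_0_le_iff)
  then have "v \<le> 0" using pos by (simp add: mult_le_0_iff)
  then show ?thesis using u by (simp add: u_def v_def)
qed

lemma face_two_points:
  assumes "card (weyl_face \<rho> \<sigma> x) > 1"  and "\<rho> > 0" "\<sigma> > 0"
  shows "\<not> (\<forall>a\<in>weyl_face \<rho> \<sigma> x. fst a = 0)" "\<not> (\<forall>a\<in>weyl_face \<rho> \<sigma> x. snd a = 0)"
proof -
  have fin: "finite (weyl_face \<rho> \<sigma> x)"
    by (rule finite_subset[OF _ finite_weyl_supp[of x]]) (auto simp: weyl_face_def)
  have supp: "a \<in> weyl_supp x" if "a \<in> weyl_face \<rho> \<sigma> x" for a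
    using that by (auto simp: weyl_face_def)
  have eq: "fst a * \<rho> + snd a * \<sigma> = fst b * \<rho> + snd b * \<sigma>"
    if "a \<in> weyl_face \<rho> \<sigma> x" "b \<in> weyl_face \<rho> \<sigma> x" for a b
    using face_weight_le[OF that(2) supp[OF that(1)]] face_weight_le[OF that(1) supp[OF that(2)]]
    by (rule antisym)
  have "\<exists>a\<in>weyl_face \<rho> \<sigma> x. \<exists>b\<in>weyl_face \<rho> \<sigma> x. a \<noteq> b"
    using card_le_Suc0_iff_eq[OF fin] assms(1) by (metis One_nat_def not_le)
  then obtain a b where ab: "a \<in> weyl_face \<rho> \<sigma> x" "b \<in> weyl_face \<rho> \<sigma> x" "a \<noteq> b" by blast
  show "\<not> (\<forall>a\<in>weyl_face \<rho> \<sigma> x. fst a = 0)"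
  proof
    assume "\<forall>a\<in>weyl_face \<rho> \<sigma> x. fst a = 0"
    then have "fst a = 0" "fst b = 0" using ab by blast+
    then show False using eq[OF ab(1,2)] ab(3) assms(3) by (simp add: prod_eq_iff)
  qed
  show "\<not> (\<forall>a\<in>weyl_face \<rho> \<sigma> x. snd a = 0)"
  proof
    assume "\<forall>a\<in>weyl_face \<rho> \<sigma> x. snd a = 0"
    then have "snd a = 0" "snd b = 0" using ab by blast+
    then show False using eq[OF ab(1,2)] ab(3) assms(2) by (simp add: prod_eq_iff)
  qed
qed

text \<open>The edge in the direction closer to the \<open>X\<close>-axis lies to the right of and below the other one. If
  it meets the \<open>Y\<close>-axis, the other edge lies on that axis; if the other edge meets the \<open>X\<close>-axis, this one
  lies on the \<open>X\<close>-axis. The preceding lemma excludes both.\<close>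

lemma at_most_one_edge:
  fixes x :: "'f::field_char_0 weyl"
  assumes "weyl_solvable x" "(\<rho>, \<sigma>) \<in> dirs" "(\<rho>', \<sigma>') \<in> dirs"
    and cards: "card (weyl_face \<rho> \<sigma> x) > 1" "card (weyl_face \<rho>' \<sigma>' x) > 1"
    and lt: "real \<rho> / real \<sigma> < real \<rho>' / real \<sigma>'"
  shows False
proof -
  have pos: "\<rho> > 0" "\<sigma> > 0" "\<rho>' > 0" "\<sigma>' > 0" using assms(2,3) by (auto simp: dirs_def)
  note ord = faces_ordered[OF _ _ pos(2,4) lt]
  show False
  proof (cases "\<rho>' > \<sigma>'")
    case True
    then obtain j where "(0, j) \<in> weyl_face \<rho>' \<sigma>' x" using face_meets_axis[OF assms(1,3) cards(2)] by blast
    then have "\<forall>a\<in>weyl_face \<rho> \<sigma> x. fst a = 0" using ord by fastforce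
    then show False using face_two_points[OF cards(1) pos(1,2)] by blast
  next
    case False
    then have "real \<rho>' / real \<sigma>' \<le> 1" using pos by simp
    then have "real \<rho> / real \<sigma> < 1" using lt by linarith
    then have "\<rho> < \<sigma>" using pos by simp
    then obtain i where "(i, 0) \<in> weyl_face \<rho> \<sigma> x" using face_meets_axis[OF assms(1,2) cards(1)] by blast
    then have "\<forall>a\<in>weyl_face \<rho>' \<sigma>' x. snd a = 0" using ord by fastforce
    then show False using face_two_points[OF cards(2) pos(3,4)] by blast
  qed
qed

theorem theorem5p6:
  fixes x :: "'f::field_char_0 weyl"
    and k :: nat
    and \<rho> \<sigma> r :: "nat \<Rightarrow> nat"
    and f :: "nat \<Rightarrow> 'f poly poly"
  assumes solvable: "weyl_solvable x"
    and val: "\<And>\<rho>' \<sigma>'. (\<rho>', \<sigma>') \<in> dirs \<Longrightarrow> weyl_val \<rho>' \<sigma>' x \<ge> ereal (real (\<rho>' + \<sigma>'))"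
    and k: "k \<ge> 2"
    and dirs: "\<And>l. l \<in> {1..k} \<Longrightarrow> (\<rho> l, \<sigma> l) \<in> dirs"
    and increasing: "\<And>l m. l \<in> {1..k} \<Longrightarrow> m \<in> {1..k} \<Longrightarrow> l < m \<Longrightarrow>
      real (\<rho> l) / real (\<sigma> l) < real (\<rho> m) / real (\<sigma> m)"
    and edges: "weyl_edges x = (\<lambda>l. weyl_face (\<rho> l) (\<sigma> l) x) ` {1..k}"
    and r: "\<And>l. l \<in> {1..k} \<Longrightarrow> r l > 1"
    and poly: "\<And>l. l \<in> {1..k} \<Longrightarrow> weyl_poly (\<rho> l) (\<sigma> l) x = f l ^ r l"
    and not_power: "\<And>l. l \<in> {1..k} \<Longrightarrow> \<not> (\<exists>(\<kappa> :: 'f poly poly) n. n > 1 \<and> f l = \<kappa> ^ n)"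
  shows "Gcd (r ` {1..k}) > 1"
proof -
  have l: "1 \<in> {1..k}" "2 \<in> {1..k}" using k by auto
  have card: "card (weyl_face (\<rho> l) (\<sigma> l) x) > 1" if "l \<in> {1..k}" for l
  proof -
    have "weyl_face (\<rho> l) (\<sigma> l) x \<in> weyl_edges x" unfolding edges using that by blast
    then show ?thesis by (auto simp: weyl_edges_def)
  qed
  have False
    by (rule at_most_one_edge[OF solvable dirs[OF l(1)] dirs[OF l(2)] card[OF l(1)] card[OF l(2)] increasing[OF l]]) simp
  then show ?thesis ..
qed

end
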